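(* Let $r\ge2$ be an integer, $a>0$, $b^{(1)},\dots,b^{(r-1)}\in\mathbb{R}$, $b^{(r)}>0$, and for $m>0$ let $$H_m=\frac{1}{2m}p^2+\frac a2q^2+V(q),\qquad V(q)=b^{(1)}q^2+b^{(2)}q^4+\cdots+b^{(r)}q^{2r},$$ acting in $L^2(\mathbb{R})$ (with $p=-i\,d/dx$, $q$ multiplication by $x$). Let $E_0<E_1<\cdots$ be its eigenvalues, $\Delta_m=\min_{n\in\mathbb{N}}(E_n-E_{n-1})$ its gap parameter and $\mathcal{R}_m=m\Delta_m^2$ its quantum rigidity. Then $\Delta_m$ and $\mathcal{R}_m$ are continuous functions of $m\in(0,\infty)$, and there is $\Delta_0>0$ such that, as $m\to0$, $$\Delta_m\sim\Delta_0\,m^{-r/(r+1)},\qquad \mathcal{R}_m\sim\Delta_0^2\,m^{-(r-1)/(r+1)},$$ where $f\sim g$ means $f/g\to1$.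
   Context: $H_m$ is essentially self-adjoint on $C_0^\infty(\mathbb{R})$, and its spectrum consists of simple eigenvalues only, so the eigenvalues can be listed in increasing order $E_0<E_1<\cdots$. *)

theory Defs
  imports "HOL-Analysis.Analysis" "HOL-Library.Landau_Symbols"
begin

definition pot :: "real \<Rightarrow> (nat \<Rightarrow> real) \<Rightarrow> nat \<Rightarrow> real \<Rightarrow> real" where
  "pot a b r x = a / 2 * x ^ 2 + (\<Sum>k = 1..r. b k * x ^ (2 * k))"

definition is_eigenvalue ::
  "real \<Rightarrow> real \<Rightarrow> (nat \<Rightarrow> real) \<Rightarrow> nat \<Rightarrow> real \<Rightarrow> bool" where
  "is_eigenvalue m a b r E \<longleftrightarrow>
     (\<exists>\<psi> \<psi>1 \<psi>2 :: real \<Rightarrow> complex.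
        (\<exists>x. \<psi> x \<noteq> 0) \<and>
        (\<lambda>x. (cmod (\<psi> x))\<^sup>2) integrable_on UNIV \<and>
        (\<forall>x. (\<psi> has_vector_derivative \<psi>1 x) (at x) \<and>
             (\<psi>1 has_vector_derivative \<psi>2 x) (at x) \<and>
             - (1 / (2 * m)) *\<^sub>R \<psi>2 x + pot a b r x *\<^sub>R \<psi> x = E *\<^sub>R \<psi> x))"

definition spec :: "real \<Rightarrow> real \<Rightarrow> (nat \<Rightarrow> real) \<Rightarrow> nat \<Rightarrow> real set" where
  "spec m a b r = {E. is_eigenvalue m a b r E}"

fun eig :: "real \<Rightarrow> real \<Rightarrow> (nat \<Rightarrow> real) \<Rightarrow> nat \<Rightarrow> nat \<Rightarrow> real" where
  "eig m a b r 0 = Inf (spec m a b r)"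
| "eig m a b r (Suc n) = Inf {E \<in> spec m a b r. E > eig m a b r n}"

definition gap :: "real \<Rightarrow> real \<Rightarrow> (nat \<Rightarrow> real) \<Rightarrow> nat \<Rightarrow> real" where
  "gap m a b r = (INF n. eig m a b r (Suc n) - eig m a b r n)"

definition rigidity :: "real \<Rightarrow> real \<Rightarrow> (nat \<Rightarrow> real) \<Rightarrow> nat \<Rightarrow> real" where
  "rigidity m a b r = m * (gap m a b r)\<^sup>2"

end

theory Submission
  imports Defs
begin

text \<open>
  With \<open>m = t ^ (r + 1)\<close>, \<open>x = y / sqrt t\<close> and \<open>E = l / (2 * t ^ r)\<close> the eigenvalue equation becomes
  \<open>- u'' + W t y * u = l * u\<close>, where \<open>W t y\<close> is a polynomial in \<open>t\<close> and \<open>y\<close> that makes sense at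
  \<open>t = 0\<close>. Hence the gap equals \<open>min_gap t / (2 * t ^ r)\<close>, and everything follows once \<open>min_gap\<close> is known
  to be continuous and positive on the whole line, with \<open>\<Delta>0 = min_gap 0 / 2\<close>.

  The even and odd solutions are entire power series depending continuously on \<open>(l, t)\<close>. Their
  Pruefer angles increase with \<open>l\<close>, cross multiples of \<open>pi\<close> only upwards and, where \<open>W > l\<close>, cross
  odd multiples of \<open>pi / 2\<close> only downwards. So the \<open>k\<close>-th eigenvalue of a given parity is the
  infimum of all \<open>l\<close> whose angle reaches \<open>(k + 1) * pi\<close>, which gives existence, continuity in \<open>t\<close> and
  interlacing of the two parities.

  Finally the gaps tend to infinity, locally uniformly in \<open>t\<close>, so that only finitely many of them
  compete for the minimum: the energy identity with weight \<open>1 / (1 + d * x)\<close> bounds the norm of an eigenfunction by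
  its initial data, and for eigenfunctions of opposite parity the Wronskian is \<open>1\<close> at the origin,
  while it equals the eigenvalue difference times their inner product on the half line.
\<close>

section \<open>Power series solutions for even polynomial potentials\<close>

text \<open>The substitution balances the kinetic term against the top power of the potential: both
  scale like \<open>t\<close> to the power \<open>- r\<close>, and a lower term of degree
  \<open>2 * k\<close> keeps the factor \<open>t ^ (r - k)\<close>. Since these factors are
  polynomial, the rescaled problem also makes sense for negative \<open>t\<close>, so
  \<open>0\<close> is an interior point and the asymptotics reduce to continuity there.

  The obstacle is that the gap is an infimum of infinitely many differences: continuity of each
  eigenvalue does not make it continuous or positive, so high gaps need a lower bound that is
  uniform in \<open>t\<close>. The unweighted energy identity does not give one, because it only
  controls \<open>u\<close> through the derivative of \<open>W\<close>, which vanishes at the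
  origin. The weight adds a term \<open>d * l\<close> that controls \<open>u\<close> there, while
  far out the growth of \<open>W\<close> takes over.

  Power series serve as solutions because their coefficient bounds depend on the equation only
  through a bound for its coefficients; joint continuity in the parameters and \<open>x\<close> is
  then a Weierstrass M-test.\<close>

fun ode_coeff :: "(nat \<Rightarrow> real) \<Rightarrow> nat \<Rightarrow> real \<Rightarrow> real \<Rightarrow> nat \<Rightarrow> real" where
  "ode_coeff q r \<alpha> \<beta> 0 = \<alpha>"
| "ode_coeff q r \<alpha> \<beta> (Suc 0) = \<beta>"
| "ode_coeff q r \<alpha> \<beta> (Suc (Suc n)) =
     (\<Sum>k\<le>r. if 2 * k \<le> n then q k * ode_coeff q r \<alpha> \<beta> (n - 2 * k) else 0)
       / (real (Suc n) * real (Suc (Suc n)))"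

lemma ode_coeff_sum_bound:
  assumes q: "\<And>k. k \<le> r \<Longrightarrow> \<bar>q k\<bar> \<le> B" and "B \<ge> 0"
    and c: "\<And>k. k \<le> r \<Longrightarrow> 2 * k \<le> n \<Longrightarrow> \<bar>ode_coeff q r \<alpha> \<beta> (n - 2 * k)\<bar> \<le> C" and "C \<ge> 0"
  shows "\<bar>ode_coeff q r \<alpha> \<beta> (Suc (Suc n))\<bar> \<le> real (r + 1) * B * C / (real (Suc n) * real (Suc (Suc n)))"
proof -
  have "\<bar>\<Sum>k\<le>r. if 2 * k \<le> n then q k * ode_coeff q r \<alpha> \<beta> (n - 2 * k) else 0\<bar>
      \<le> (\<Sum>k\<le>r. \<bar>if 2 * k \<le> n then q k * ode_coeff q r \<alpha> \<beta> (n - 2 * k) else 0\<bar>)"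
    by (rule sum_abs)
  also have "\<dots> \<le> (\<Sum>k\<le>r. B * C)"
    using assms by (intro sum_mono) (auto simp: abs_mult intro!: mult_mono)
  finally show ?thesis
    by (simp add: abs_mult divide_right_mono mult.assoc)
qed

lemma ode_coeff_crude_bound:
  assumes q: "\<And>k. k \<le> r \<Longrightarrow> \<bar>q k\<bar> \<le> B" and "B \<ge> 0" "\<bar>\<alpha>\<bar> \<le> 1" "\<bar>\<beta>\<bar> \<le> 1"
  shows "\<bar>ode_coeff q r \<alpha> \<beta> n\<bar> \<le> (1 + real (r + 1) * B) ^ n"
proof (induction n rule: less_induct)
  case (less n)
  define L where "L = 1 + real (r + 1) * B"
  have L: "L \<ge> 1" using \<open>B \<ge> 0\<close> by (simp add: L_def)
  consider "n = 0" | "n = Suc 0" | m where "n = Suc (Suc m)" by (metis not0_implies_Suc)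
  then show ?case
  proof cases
    case 2
    have "(1 + real r) * B \<ge> 0" using \<open>B \<ge> 0\<close> by simp
    then show ?thesis using 2 \<open>\<bar>\<beta>\<bar> \<le> 1\<close> by simp
  next
    case 3
    have "\<bar>ode_coeff q r \<alpha> \<beta> (m - 2 * k)\<bar> \<le> L ^ m" for k
    proof -
      have "\<bar>ode_coeff q r \<alpha> \<beta> (m - 2 * k)\<bar> \<le> L ^ (m - 2 * k)"
        using less[of "m - 2 * k"] 3 by (simp add: L_def)
      also have "\<dots> \<le> L ^ m" using L by (intro power_increasing) auto
      finally show ?thesis .
    qed
    then have "\<bar>ode_coeff q r \<alpha> \<beta> (Suc (Suc m))\<bar>
        \<le> real (r + 1) * B * L ^ m / (real (Suc m) * real (Suc (Suc m)))"
      using assms L by (intro ode_coeff_sum_bound) auto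
    also have "\<dots> \<le> real (r + 1) * B * L ^ m"
    proof -
      have "1 * 1 \<le> real (Suc m) * real (Suc (Suc m))" by (intro mult_mono) auto
      then have "real (r + 1) * B * L ^ m / (real (Suc m) * real (Suc (Suc m))) \<le> real (r + 1) * B * L ^ m / 1"
        using \<open>B \<ge> 0\<close> L by (intro divide_left_mono) (auto simp del: of_nat_Suc)
      then show ?thesis by simp
    qed
    also have "\<dots> \<le> L * L ^ m" using L by (intro mult_right_mono) (auto simp: L_def)
    also have "\<dots> = L ^ Suc m" by simp
    also have "\<dots> \<le> L ^ n" using L 3 by (intro power_increasing) auto
    finally show ?thesis using 3 by (simp add: L_def)
  qed (use assms L in \<open>auto simp: L_def\<close>)
qed

text \<open>The recursion divides by \<open>(n + 1) * (n + 2)\<close>, which eventually outweighs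
  \<open>(r + 1) * B\<close> and the factor lost by comparing indices up to \<open>2 * r + 2\<close>
  apart. From there on the bound propagates; the finitely many earlier coefficients are absorbed
  into \<open>M\<close> by the crude bound. As \<open>\<rho>\<close> may be arbitrarily small and
  \<open>M\<close> does not depend on \<open>q\<close>, the series are entire with uniform
  control.\<close>

lemma ode_coeff_bound:
  fixes \<rho> :: real
  assumes "0 < \<rho>" "\<rho> \<le> 1" "B \<ge> 0" "\<bar>\<alpha>\<bar> \<le> 1" "\<bar>\<beta>\<bar> \<le> 1"
  obtains M where "M \<ge> 0" "\<And>q n. (\<And>k. k \<le> r \<Longrightarrow> \<bar>q k\<bar> \<le> B) \<Longrightarrow> \<bar>ode_coeff q r \<alpha> \<beta> n\<bar> \<le> M * \<rho> ^ n"
proof -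
  define L where "L = 1 + real (r + 1) * B"
  have L: "L \<ge> 1" using \<open>B \<ge> 0\<close> by (simp add: L_def)
  obtain N :: nat where N: "real N \<ge> real (r + 1) * B / \<rho> ^ (2 * r + 2)"
    using real_arch_simple by blast
  define M where "M = (L / \<rho>) ^ (N + 2)"
  have Lr: "L / \<rho> \<ge> 1" using L assms by (simp add: field_simps)
  have M: "M \<ge> 0" unfolding M_def using Lr by (intro zero_le_power) linarith
  have "\<bar>ode_coeff q r \<alpha> \<beta> n\<bar> \<le> M * \<rho> ^ n" if q: "\<And>k. k \<le> r \<Longrightarrow> \<bar>q k\<bar> \<le> B" for q n
  proof (induction n rule: less_induct)
    case (less n)
    show ?case
    proof (cases "n < N + 2")
      case True
      have "\<bar>ode_coeff q r \<alpha> \<beta> n\<bar> \<le> L ^ n"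
        using ode_coeff_crude_bound[OF q] assms by (simp add: L_def)
      also have "\<dots> = (L / \<rho>) ^ n * \<rho> ^ n" using assms by (simp add: power_divide)
      also have "\<dots> \<le> M * \<rho> ^ n"
        unfolding M_def using True assms Lr by (intro mult_right_mono power_increasing) auto
      finally show ?thesis .
    next
      case False
      define m where "m = n - 2"
      have m: "n = Suc (Suc m)" "m \<ge> N" using False by (auto simp: m_def)
      have "\<bar>ode_coeff q r \<alpha> \<beta> (m - 2 * k)\<bar> \<le> M * \<rho> ^ m / \<rho> ^ (2 * r)" if "k \<le> r" "2 * k \<le> m" for k
      proof -
        have "\<bar>ode_coeff q r \<alpha> \<beta> (m - 2 * k)\<bar> \<le> M * \<rho> ^ (m - 2 * k)"
          using less[of "m - 2 * k"] m by simp
        also have "\<dots> = M * \<rho> ^ m / \<rho> ^ (2 * k)"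
          using that assms by (simp add: power_diff)
        also have "\<dots> \<le> M * \<rho> ^ m / \<rho> ^ (2 * r)"
          using that assms M by (intro divide_left_mono power_decreasing) (auto intro!: mult_nonneg_nonneg)
        finally show ?thesis .
      qed
      then have "\<bar>ode_coeff q r \<alpha> \<beta> n\<bar> \<le> real (r + 1) * B * (M * \<rho> ^ m / \<rho> ^ (2 * r)) / (real (Suc m) * real (Suc (Suc m)))"
        unfolding m(1) using assms M q by (intro ode_coeff_sum_bound) auto
      also have "\<dots> = (real (r + 1) * B / \<rho> ^ (2 * r + 2)) * (M * \<rho> ^ n) / (real (Suc m) * real (Suc (Suc m)))"
      proof -
        have "real (r + 1) * B * (M * \<rho> ^ m / \<rho> ^ (2 * r)) = (real (r + 1) * B / \<rho> ^ (2 * r + 2)) * (M * \<rho> ^ n)"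
          using assms by (simp add: m power_add power2_eq_square)
        then show ?thesis by simp
      qed
      also have "\<dots> \<le> (real (Suc m) * real (Suc (Suc m))) * (M * \<rho> ^ n) / (real (Suc m) * real (Suc (Suc m)))"
      proof (intro divide_right_mono mult_right_mono)
        have "real (r + 1) * B / \<rho> ^ (2 * r + 2) \<le> real m" using N m by linarith
        also have "\<dots> \<le> real (Suc m) * real (Suc (Suc m))" by (simp add: algebra_simps)
        finally show "real (r + 1) * B / \<rho> ^ (2 * r + 2) \<le> real (Suc m) * real (Suc (Suc m))" .
      qed (use M assms in auto)
      finally show ?thesis by (simp del: of_nat_Suc)
    qed
  qed
  with M that show ?thesis by blast
qed

lemma ode_coeff_powser_bound:
  fixes R :: real
  assumes "B \<ge> 0" "\<bar>\<alpha>\<bar> \<le> 1" "\<bar>\<beta>\<bar> \<le> 1"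
  obtains M where "\<And>q n x. (\<And>k. k \<le> r \<Longrightarrow> \<bar>q k\<bar> \<le> B) \<Longrightarrow> \<bar>x\<bar> \<le> R \<Longrightarrow> \<bar>ode_coeff q r \<alpha> \<beta> n * x ^ n\<bar> \<le> M * (1/2) ^ n"
    "\<And>q n x. (\<And>k. k \<le> r \<Longrightarrow> \<bar>q k\<bar> \<le> B) \<Longrightarrow> \<bar>x\<bar> \<le> R \<Longrightarrow> \<bar>diffs (ode_coeff q r \<alpha> \<beta>) n * x ^ n\<bar> \<le> M * (1/2) ^ n"
proof -
  define S where "S = \<bar>R\<bar> + 1"
  have S: "S \<ge> 1" "R \<le> S" by (auto simp: S_def)
  \<comment> \<open>With \<open>1/4\<close> in place of \<open>1/2\<close>, the factor
    \<open>n + 1 \<le> 2 ^ n\<close> from differentiation still leaves a geometric series of ratio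
    \<open>1/2\<close>.\<close>
  define \<rho> where "\<rho> = 1 / (4 * S)"
  have \<rho>: "0 < \<rho>" "\<rho> \<le> 1" "\<rho> * S = 1/4" using S by (auto simp: \<rho>_def field_simps)
  obtain M where M: "M \<ge> 0" "\<And>q n. (\<And>k. k \<le> r \<Longrightarrow> \<bar>q k\<bar> \<le> B) \<Longrightarrow> \<bar>ode_coeff q r \<alpha> \<beta> n\<bar> \<le> M * \<rho> ^ n"
    using ode_coeff_bound[OF \<rho>(1,2) assms] by metis
  show ?thesis
  proof (rule that[of M])
    fix q n and x :: real assume q: "\<And>k. k \<le> r \<Longrightarrow> \<bar>q k\<bar> \<le> B" and x: "\<bar>x\<bar> \<le> R"
    have xS: "\<bar>x\<bar> ^ n \<le> S ^ n" using x S by (intro power_mono) auto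
    have "\<bar>ode_coeff q r \<alpha> \<beta> n * x ^ n\<bar> \<le> (M * \<rho> ^ n) * S ^ n"
      unfolding abs_mult power_abs using M(2)[of q n] q xS M(1) \<rho> by (intro mult_mono) auto
    also have "\<dots> = M * (1/4) ^ n" using \<rho> by (metis mult.assoc power_mult_distrib)
    also have "\<dots> \<le> M * (1/2) ^ n" using M by (intro mult_left_mono power_mono) auto
    finally show "\<bar>ode_coeff q r \<alpha> \<beta> n * x ^ n\<bar> \<le> M * (1/2) ^ n" .
    have "\<bar>diffs (ode_coeff q r \<alpha> \<beta>) n * x ^ n\<bar> = real (Suc n) * \<bar>ode_coeff q r \<alpha> \<beta> (Suc n)\<bar> * \<bar>x\<bar> ^ n"
      by (simp add: diffs_def abs_mult power_abs)
    also have "\<dots> \<le> 2 ^ n * (M * \<rho> ^ Suc n) * S ^ n"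
    proof (intro mult_mono)
      have "Suc n \<le> 2 ^ n" by (induction n) auto
      then show "real (Suc n) \<le> 2 ^ n" by (metis of_nat_le_iff of_nat_numeral of_nat_power)
      show "\<bar>ode_coeff q r \<alpha> \<beta> (Suc n)\<bar> \<le> M * \<rho> ^ Suc n" using M(2)[of q "Suc n"] q by blast
    qed (use xS M(1) \<rho> S in \<open>auto simp del: power_Suc\<close>)
    also have "\<dots> = \<rho> * (M * (2 * (\<rho> * S)) ^ n)"
      by (simp add: power_mult_distrib)
    also have "\<dots> \<le> 1 * (M * (1/2) ^ n)"
    proof (intro mult_mono)
      show "(2 * (\<rho> * S)) ^ n \<le> (1/2) ^ n" unfolding \<rho>(3) by simp
    qed (use M \<rho> S in auto)
    finally show "\<bar>diffs (ode_coeff q r \<alpha> \<beta>) n * x ^ n\<bar> \<le> M * (1/2) ^ n" by simp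
  qed
qed

definition ode_sol :: "(nat \<Rightarrow> real) \<Rightarrow> nat \<Rightarrow> real \<Rightarrow> real \<Rightarrow> real \<Rightarrow> real" where
  "ode_sol q r \<alpha> \<beta> x = (\<Sum>n. ode_coeff q r \<alpha> \<beta> n * x ^ n)"

definition ode_sol' :: "(nat \<Rightarrow> real) \<Rightarrow> nat \<Rightarrow> real \<Rightarrow> real \<Rightarrow> real \<Rightarrow> real" where
  "ode_sol' q r \<alpha> \<beta> x = (\<Sum>n. diffs (ode_coeff q r \<alpha> \<beta>) n * x ^ n)"

lemma
  assumes "\<bar>\<alpha>\<bar> \<le> 1" "\<bar>\<beta>\<bar> \<le> 1"
  shows summable_ode_coeff: "summable (\<lambda>n. ode_coeff q r \<alpha> \<beta> n * x ^ n)"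
    and summable_diffs_ode_coeff: "summable (\<lambda>n. diffs (ode_coeff q r \<alpha> \<beta>) n * x ^ n)"
proof -
  define B where "B = (\<Sum>k\<le>r. \<bar>q k\<bar>)"
  have q: "\<bar>q k\<bar> \<le> B" if "k \<le> r" for k
    unfolding B_def using that by (intro member_le_sum) auto
  have B: "B \<ge> 0" by (simp add: B_def sum_nonneg)
  obtain M where M: "\<And>n. \<bar>ode_coeff q r \<alpha> \<beta> n * x ^ n\<bar> \<le> M * (1/2) ^ n"
    "\<And>n. \<bar>diffs (ode_coeff q r \<alpha> \<beta>) n * x ^ n\<bar> \<le> M * (1/2) ^ n"
    using ode_coeff_powser_bound[OF B assms, of r "\<bar>x\<bar>"] q by (metis order_refl)
  have s: "summable (\<lambda>n. M * (1/2) ^ n)" by (intro summable_mult summable_geometric) auto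
  show "summable (\<lambda>n. ode_coeff q r \<alpha> \<beta> n * x ^ n)" "summable (\<lambda>n. diffs (ode_coeff q r \<alpha> \<beta>) n * x ^ n)"
    using M by (auto intro!: summable_comparison_test'[OF s])
qed

lemma ode_sol_deriv:
  assumes "\<bar>\<alpha>\<bar> \<le> 1" "\<bar>\<beta>\<bar> \<le> 1"
  shows "(ode_sol q r \<alpha> \<beta> has_real_derivative ode_sol' q r \<alpha> \<beta> x) (at x)"
  unfolding ode_sol_def[abs_def] ode_sol'_def
  by (intro termdiffs_strong_converges_everywhere summable_ode_coeff assms)

lemma ode_sol'_deriv:
  assumes "\<bar>\<alpha>\<bar> \<le> 1" "\<bar>\<beta>\<bar> \<le> 1"
  shows "(ode_sol' q r \<alpha> \<beta> has_real_derivative (\<Sum>k\<le>r. q k * x ^ (2 * k)) * ode_sol q r \<alpha> \<beta> x) (at x)"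
proof -
  have "(\<lambda>n. diffs (diffs (ode_coeff q r \<alpha> \<beta>)) n * x ^ n) sums ((\<Sum>k\<le>r. q k * x ^ (2 * k)) * ode_sol q r \<alpha> \<beta> x)"
  proof -
    have "(\<lambda>n. (if 2 * k \<le> n then q k * ode_coeff q r \<alpha> \<beta> (n - 2 * k) else 0) * x ^ n)
           sums (q k * x ^ (2 * k) * ode_sol q r \<alpha> \<beta> x)" for k
    proof -
      have "(\<lambda>n. q k * x ^ (2 * k) * (ode_coeff q r \<alpha> \<beta> n * x ^ n)) sums (q k * x ^ (2 * k) * ode_sol q r \<alpha> \<beta> x)"
        unfolding ode_sol_def by (intro sums_mult summable_sums summable_ode_coeff assms)
      then have "(\<lambda>n. (if 2 * k \<le> n + 2 * k then q k * ode_coeff q r \<alpha> \<beta> (n + 2 * k - 2 * k) else 0) * x ^ (n + 2 * k))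
           sums (q k * x ^ (2 * k) * ode_sol q r \<alpha> \<beta> x)"
        by (simp add: power_add mult_ac)
      then show ?thesis
        by (subst (asm) sums_zero_iff_shift) auto
    qed
    then have "(\<lambda>n. \<Sum>k\<le>r. (if 2 * k \<le> n then q k * ode_coeff q r \<alpha> \<beta> (n - 2 * k) else 0) * x ^ n)
        sums (\<Sum>k\<le>r. q k * x ^ (2 * k) * ode_sol q r \<alpha> \<beta> x)"
      by (intro sums_sum)
    moreover have "(\<Sum>k\<le>r. (if 2 * k \<le> n then q k * ode_coeff q r \<alpha> \<beta> (n - 2 * k) else 0) * x ^ n)
        = diffs (diffs (ode_coeff q r \<alpha> \<beta>)) n * x ^ n" for n
      by (simp add: diffs_def sum_distrib_right[symmetric] del: of_nat_Suc)
    ultimately show ?thesis by (simp add: sum_distrib_right)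
  qed
  then have "(\<Sum>n. diffs (diffs (ode_coeff q r \<alpha> \<beta>)) n * x ^ n) = (\<Sum>k\<le>r. q k * x ^ (2 * k)) * ode_sol q r \<alpha> \<beta> x"
    by (simp add: sums_iff)
  then show ?thesis
    unfolding ode_sol'_def[abs_def]
    using termdiffs_strong_converges_everywhere[of "diffs (ode_coeff q r \<alpha> \<beta>)" x] summable_diffs_ode_coeff[OF assms]
    by metis
qed

lemma ode_sol_0 [simp]: "ode_sol q r \<alpha> \<beta> 0 = \<alpha>" "ode_sol' q r \<alpha> \<beta> 0 = \<beta>"
  by (simp_all add: ode_sol_def ode_sol'_def powser_zero diffs_def)

lemma ode_coeff_odd: "odd n \<Longrightarrow> ode_coeff q r \<alpha> 0 n = 0"
proof (induction n rule: less_induct)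
  case (less n)
  consider "n = 0" | "n = Suc 0" | m where "n = Suc (Suc m)" by (metis not0_implies_Suc)
  then show ?case using less by cases (auto intro!: sum.neutral)
qed

lemma ode_coeff_even: "even n \<Longrightarrow> ode_coeff q r 0 \<beta> n = 0"
proof (induction n rule: less_induct)
  case (less n)
  consider "n = 0" | "n = Suc 0" | m where "n = Suc (Suc m)" by (metis not0_implies_Suc)
  then show ?case using less by cases (auto intro!: sum.neutral)
qed

lemma ode_sol_minus:
  "ode_sol q r \<alpha> 0 (- x) = ode_sol q r \<alpha> 0 x"
  "\<bar>\<beta>\<bar> \<le> 1 \<Longrightarrow> ode_sol q r 0 \<beta> (- x) = - ode_sol q r 0 \<beta> x"
proof -
  have "ode_coeff q r \<alpha> 0 n * (- x) ^ n = ode_coeff q r \<alpha> 0 n * x ^ n" for n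
    by (cases "even n") (simp_all add: ode_coeff_odd)
  then show "ode_sol q r \<alpha> 0 (- x) = ode_sol q r \<alpha> 0 x" unfolding ode_sol_def by presburger
  assume "\<bar>\<beta>\<bar> \<le> 1"
  have "ode_coeff q r 0 \<beta> n * (- x) ^ n = - (ode_coeff q r 0 \<beta> n * x ^ n)" for n
    by (cases "even n") (simp_all add: ode_coeff_even)
  then show "ode_sol q r 0 \<beta> (- x) = - ode_sol q r 0 \<beta> x"
    unfolding ode_sol_def using suminf_minus[OF summable_ode_coeff[of 0 \<beta> q r x]] \<open>\<bar>\<beta>\<bar> \<le> 1\<close> by simp
qed

lemma continuous_on_ode_coeff:
  assumes "\<And>k. k \<le> r \<Longrightarrow> continuous_on A (\<lambda>p. q p k)"
  shows "continuous_on A (\<lambda>p. ode_coeff (q p) r \<alpha> \<beta> n)"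
proof (induction n rule: less_induct)
  case (less n)
  consider "n = 0" | "n = Suc 0" | m where "n = Suc (Suc m)" by (metis not0_implies_Suc)
  then show ?case
  proof cases
    case 3
    have "continuous_on A (\<lambda>p. if 2 * k \<le> m then q p k * ode_coeff (q p) r \<alpha> \<beta> (m - 2 * k) else 0)" if "k \<le> r" for k
      using assms[OF that] less[of "m - 2 * k"] 3 by (cases "2 * k \<le> m") (auto intro!: continuous_on_mult)
    then show ?thesis unfolding 3 by (auto intro!: continuous_intros simp del: of_nat_Suc)
  qed auto
qed

text \<open>On the neighbourhood \<open>U\<close> of \<open>p0\<close> the coefficients of the
  equation are bounded by \<open>f p0 + 1\<close>, so one majorant serves all of \<open>V\<close>
  and the partial sums converge uniformly there.\<close>

lemma
  fixes q :: "'p::t2_space \<Rightarrow> nat \<Rightarrow> real"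
  assumes q: "\<And>k. k \<le> r \<Longrightarrow> continuous_on UNIV (\<lambda>p. q p k)" and ab: "\<bar>\<alpha>\<bar> \<le> 1" "\<bar>\<beta>\<bar> \<le> 1"
  shows continuous_on_ode_sol: "continuous_on UNIV (\<lambda>(p, x). ode_sol (q p) r \<alpha> \<beta> x)"
    and continuous_on_ode_sol': "continuous_on UNIV (\<lambda>(p, x). ode_sol' (q p) r \<alpha> \<beta> x)"
proof -
  have "isCont (\<lambda>(p, x). ode_sol (q p) r \<alpha> \<beta> x) (p0, x0) \<and> isCont (\<lambda>(p, x). ode_sol' (q p) r \<alpha> \<beta> x) (p0, x0)" for p0 x0
  proof -
    define f where "f = (\<lambda>p. \<Sum>k\<le>r. \<bar>q p k\<bar>)"
    have f: "continuous_on UNIV f" unfolding f_def using q by (auto intro!: continuous_intros)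
    define U where "U = {p. f p < f p0 + 1}"
    have U: "open U" "p0 \<in> U"
      unfolding U_def using f by (auto intro!: open_Collect_less continuous_intros)
    define V where "V = U \<times> {- (\<bar>x0\<bar> + 1)<..<\<bar>x0\<bar> + 1}"
    have V: "open V" "(p0, x0) \<in> V" using U by (auto simp: V_def open_Times)
    have bd: "\<bar>q p k\<bar> \<le> f p0 + 1" if "p \<in> U" "k \<le> r" for p k
    proof -
      have "\<bar>q p k\<bar> \<le> f p" unfolding f_def using that by (intro member_le_sum) auto
      then show ?thesis using that by (auto simp: U_def)
    qed
    have B: "f p0 + 1 \<ge> 0" by (simp add: f_def sum_nonneg add_nonneg_nonneg)
    obtain M where M: "\<And>q n x. (\<And>k. k \<le> r \<Longrightarrow> \<bar>q k\<bar> \<le> f p0 + 1) \<Longrightarrow> \<bar>x\<bar> \<le> \<bar>x0\<bar> + 1 \<Longrightarrow> \<bar>ode_coeff q r \<alpha> \<beta> n * x ^ n\<bar> \<le> M * (1/2) ^ n"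
    "\<And>q n x. (\<And>k. k \<le> r \<Longrightarrow> \<bar>q k\<bar> \<le> f p0 + 1) \<Longrightarrow> \<bar>x\<bar> \<le> \<bar>x0\<bar> + 1 \<Longrightarrow> \<bar>diffs (ode_coeff q r \<alpha> \<beta>) n * x ^ n\<bar> \<le> M * (1/2) ^ n"
      using ode_coeff_powser_bound[OF B ab, where r = r and R = "\<bar>x0\<bar> + 1"] by blast
    have s: "summable (\<lambda>n. M * (1/2) ^ n)" by (intro summable_mult summable_geometric) auto
    have cc: "continuous_on V (\<lambda>z. ode_coeff (q (fst z)) r \<alpha> \<beta> n)" for n
      by (rule continuous_on_compose2[OF continuous_on_ode_coeff[OF q, where n = n]]) (auto intro!: continuous_intros)
    have "uniform_limit V (\<lambda>n z. \<Sum>i<n. ode_coeff (q (fst z)) r \<alpha> \<beta> i * snd z ^ i)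
        (\<lambda>z. \<Sum>i. ode_coeff (q (fst z)) r \<alpha> \<beta> i * snd z ^ i) sequentially"
      using M(1) bd by (intro Weierstrass_m_test[OF _ s]) (auto simp: V_def)
    then have "continuous_on V (\<lambda>z. \<Sum>i. ode_coeff (q (fst z)) r \<alpha> \<beta> i * snd z ^ i)"
      by (rule uniform_limit_theorem[rotated]) (auto intro!: always_eventually continuous_intros cc)
    moreover have "uniform_limit V (\<lambda>n z. \<Sum>i<n. diffs (ode_coeff (q (fst z)) r \<alpha> \<beta>) i * snd z ^ i)
        (\<lambda>z. \<Sum>i. diffs (ode_coeff (q (fst z)) r \<alpha> \<beta>) i * snd z ^ i) sequentially"
      using M(2) bd by (intro Weierstrass_m_test[OF _ s]) (auto simp: V_def)
    then have "continuous_on V (\<lambda>z. \<Sum>i. diffs (ode_coeff (q (fst z)) r \<alpha> \<beta>) i * snd z ^ i)"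
      unfolding diffs_def
      by (rule uniform_limit_theorem[rotated]) (auto intro!: always_eventually continuous_intros cc simp del: of_nat_Suc)
    ultimately show ?thesis
      using V by (simp add: ode_sol_def ode_sol'_def case_prod_unfold continuous_on_eq_continuous_at)
  qed
  then show "continuous_on UNIV (\<lambda>(p, x). ode_sol (q p) r \<alpha> \<beta> x)" "continuous_on UNIV (\<lambda>(p, x). ode_sol' (q p) r \<alpha> \<beta> x)"
    by (auto intro!: continuous_at_imp_continuous_on)
qed

section \<open>The Pruefer angle\<close>

text \<open>The sign of \<open>f'\<close> is required only on the level set \<open>f = c\<close>;
  for the angle this is exactly where its derivative has a known sign. Derivatives are taken within
  the interval because the angle is only considered on the half line.\<close>

lemma cross_up:
  fixes f f' :: "real \<Rightarrow> real"
  assumes ab: "a \<le> b" and d: "\<And>x. x \<in> {a..b} \<Longrightarrow> (f has_real_derivative f' x) (at x within {a..b})"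
    and "f a \<ge> c" and pos: "\<And>x. x \<in> {a..b} \<Longrightarrow> f x = c \<Longrightarrow> f' x > 0"
  shows "f b \<ge> c" and "a < b \<Longrightarrow> f b > c"
proof -
  have cont: "continuous_on {a..b} f"
    by (rule DERIV_continuous_on[OF d])
  have ge: "f y \<ge> c" if y: "y \<in> {a..b}" for y
  proof (rule ccontr)
    assume "\<not> f y \<ge> c"
    then have fy: "f y < c" by simp
    define Z where "Z = {x \<in> {a..y}. f x = c}"
    have "\<exists>x\<ge>a. x \<le> y \<and> f x = c"
      using fy y assms(3) by (intro IVT2' continuous_on_subset[OF cont]) auto
    then have "Z \<noteq> {}" by (auto simp: Z_def)
    moreover have "compact Z"
    proof -
      have "closed Z" unfolding Z_def
        by (intro continuous_closed_preimage_constant continuous_on_subset[OF cont]) (use y in auto)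
      moreover have "bounded Z" by (rule bounded_subset[of "{a..y}"]) (auto simp: Z_def)
      ultimately show ?thesis by (simp add: compact_eq_bounded_closed)
    qed
    ultimately have "\<exists>s\<in>Z. \<forall>z\<in>Z. z \<le> s"
      by (intro compact_attains_sup)
    then obtain s where s: "s \<in> Z" "\<And>z. z \<in> Z \<Longrightarrow> z \<le> s" by auto
    have "s \<noteq> y" using s(1) fy by (auto simp: Z_def)
    then have s': "a \<le> s" "s < y" "f s = c" using s(1) by (auto simp: Z_def)
    then have "f' s > 0" using pos y by auto
    then obtain e where e: "e > 0" "\<And>h. h > 0 \<Longrightarrow> s + h \<in> {a..b} \<Longrightarrow> h < e \<Longrightarrow> f s < f (s + h)"
      using has_real_derivative_pos_inc_right[OF d[of s]] s' y \<open>f' s > 0\<close> by auto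
    define h where "h = min (e / 2) (y - s)"
    have h: "h > 0" "h < e" "s + h \<le> y" using e s' by (auto simp: h_def min_def)
    have "f (s + h) > c" using e(2)[of h] h s' y by auto
    then have "\<exists>x\<ge>s + h. x \<le> y \<and> f x = c"
      using fy y h s' by (intro IVT2' continuous_on_subset[OF cont]) auto
    then obtain x where "s + h \<le> x" "x \<le> y" "f x = c" by blast
    then have "x \<in> Z" using h s' by (auto simp: Z_def)
    then show False using s(2)[of x] \<open>s + h \<le> x\<close> h by auto
  qed
  show "f b \<ge> c" using ge ab by auto
  assume "a < b"
  show "f b > c"
  proof (rule ccontr)
    assume "\<not> f b > c"
    then have fb: "f b = c" using ge[of b] ab by auto
    then have "f' b > 0" using pos ab by auto
    then obtain e where e: "e > 0" "\<And>h. h > 0 \<Longrightarrow> b - h \<in> {a..b} \<Longrightarrow> h < e \<Longrightarrow> f (b - h) < f b"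
      using has_real_derivative_pos_inc_left[OF d[of b]] ab \<open>f' b > 0\<close> by auto
    define h where "h = min (e / 2) (b - a)"
    have h: "h > 0" "h < e" "b - h \<ge> a" using e \<open>a < b\<close> by (auto simp: h_def min_def)
    then show False using e(2)[of h] ge[of "b - h"] fb by auto
  qed
qed

lemma cross_down:
  fixes f f' :: "real \<Rightarrow> real"
  assumes ab: "a \<le> b" and d: "\<And>x. x \<in> {a..b} \<Longrightarrow> (f has_real_derivative f' x) (at x within {a..b})"
    and "f a \<le> c" and neg: "\<And>x. x \<in> {a..b} \<Longrightarrow> f x = c \<Longrightarrow> f' x < 0"
  shows "f b \<le> c" and "a < b \<Longrightarrow> f b < c"
proof -
  have d': "((\<lambda>x. - f x) has_real_derivative - f' x) (at x within {a..b})" if "x \<in> {a..b}" for x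
    using that by (intro DERIV_minus d)
  note * = cross_up[of a b "\<lambda>x. - f x" "\<lambda>x. - f' x" "- c", OF ab d']
  show "f b \<le> c" "a < b \<Longrightarrow> f b < c" using * assms(3) neg by auto
qed

text \<open>Only the lower terms carry powers of \<open>t\<close>, so \<open>A\<close> depends on
  \<open>t\<close> through \<open>T\<close> alone. The polynomials \<open>W\<close>,
  \<open>x * dW\<close> and \<open>x * dW - W\<close> all have this shape with a positive leading
  coefficient.\<close>

lemma leading_term_dominates:
  fixes d :: "nat \<Rightarrow> real"
  assumes "r \<ge> 1" "d r > 0"
  shows "\<exists>A\<ge>1. \<forall>t x. \<bar>t\<bar> \<le> T \<longrightarrow> x \<ge> A \<longrightarrow> (\<Sum>k = 1..r. d k * t ^ (r - k) * x ^ (2 * k)) \<ge> d r / 2 * x ^ (2 * r)"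
proof -
  define D where "D = (\<Sum>k = 1..<r. \<bar>d k\<bar> * (1 + \<bar>T\<bar>) ^ r)"
  have D: "D \<ge> 0" by (simp add: D_def sum_nonneg)
  \<comment> \<open>All lower terms together are at most \<open>D * x ^ (2 * r - 1)\<close>, which
    for \<open>x \<ge> A\<close> is at most half of the leading term.\<close>
  define A where "A = 1 + 2 * D / d r"
  show ?thesis
  proof (intro exI[of _ A] conjI allI impI)
    show "A \<ge> 1" using D assms by (simp add: A_def)
    fix t x :: real assume t: "\<bar>t\<bar> \<le> T" and x: "x \<ge> A"
    have x1: "x \<ge> 1" using x \<open>A \<ge> 1\<close> by simp
    have "- (d k * t ^ (r - k) * x ^ (2 * k)) \<le> \<bar>d k\<bar> * (1 + \<bar>T\<bar>) ^ r * x ^ (2 * r - 1)" if "k \<in> {1..<r}" for k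
    proof -
      have "- (d k * t ^ (r - k) * x ^ (2 * k)) \<le> \<bar>d k * t ^ (r - k) * x ^ (2 * k)\<bar>" by linarith
      also have "\<dots> = \<bar>d k\<bar> * \<bar>t\<bar> ^ (r - k) * x ^ (2 * k)" using x1 by (simp add: abs_mult power_abs)
      also have "\<dots> \<le> \<bar>d k\<bar> * (1 + \<bar>T\<bar>) ^ r * x ^ (2 * r - 1)"
      proof (intro mult_mono)
        have "\<bar>t\<bar> ^ (r - k) \<le> (1 + \<bar>T\<bar>) ^ (r - k)" using t by (intro power_mono) auto
        also have "\<dots> \<le> (1 + \<bar>T\<bar>) ^ r" by (intro power_increasing) auto
        finally show "\<bar>t\<bar> ^ (r - k) \<le> (1 + \<bar>T\<bar>) ^ r" .
        show "x ^ (2 * k) \<le> x ^ (2 * r - 1)" using x1 that by (intro power_increasing) auto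
      qed (use x1 in auto)
      finally show ?thesis .
    qed
    then have "- (\<Sum>k = 1..<r. d k * t ^ (r - k) * x ^ (2 * k)) \<le> (\<Sum>k = 1..<r. \<bar>d k\<bar> * (1 + \<bar>T\<bar>) ^ r * x ^ (2 * r - 1))"
      unfolding sum_negf[symmetric] by (intro sum_mono)
    also have "\<dots> = D * x ^ (2 * r - 1)" by (simp add: D_def sum_distrib_right)
    also have "\<dots> \<le> (d r / 2 * x) * x ^ (2 * r - 1)"
    proof (intro mult_right_mono)
      have "2 * D / d r \<le> x" using x by (simp add: A_def)
      then show "D \<le> d r / 2 * x" using assms by (simp add: field_simps)
    qed (use x1 in auto)
    also have "\<dots> = d r / 2 * x ^ (2 * r)"
      using assms by (cases r) (auto simp: mult_ac)
    finally have "- (\<Sum>k = 1..<r. d k * t ^ (r - k) * x ^ (2 * k)) \<le> d r / 2 * x ^ (2 * r)" .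
    moreover have "(\<Sum>k = 1..r. d k * t ^ (r - k) * x ^ (2 * k)) = (\<Sum>k = 1..<r. d k * t ^ (r - k) * x ^ (2 * k)) + d r * x ^ (2 * r)"
    proof -
      have "{1..r} = insert r {1..<r}" using assms by auto
      then show ?thesis by simp
    qed
    ultimately show "(\<Sum>k = 1..r. d k * t ^ (r - k) * x ^ (2 * k)) \<ge> d r / 2 * x ^ (2 * r)" by argo
  qed
qed

section \<open>The rescaled equation and its even and odd solutions\<close>

locale anharmonic =
  fixes r :: nat and v :: "nat \<Rightarrow> real"
  assumes r2: "r \<ge> 2" and vr: "v r > 0"
begin

definition q :: "real \<Rightarrow> real \<Rightarrow> nat \<Rightarrow> real" where
  "q l t k = (if k = 0 then - l else 2 * v k * t ^ (r - k))"

text \<open>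
  The parameter \<open>l\<close> is the rescaled eigenvalue, and \<open>t\<close> is \<open>m powr (1 / (r + 1))\<close>; the value \<open>t = 0\<close>
  is the limit of vanishing mass. The flag \<open>e\<close> selects the even solution.
\<close>

definition W :: "real \<Rightarrow> real \<Rightarrow> real" where
  "W t x = (\<Sum>k = 1..r. 2 * v k * t ^ (r - k) * x ^ (2 * k))"

definition u :: "bool \<Rightarrow> real \<Rightarrow> real \<Rightarrow> real \<Rightarrow> real" where
  "u e l t = ode_sol (q l t) r (if e then 1 else 0) (if e then 0 else 1)"

definition du :: "bool \<Rightarrow> real \<Rightarrow> real \<Rightarrow> real \<Rightarrow> real" where
  "du e l t = ode_sol' (q l t) r (if e then 1 else 0) (if e then 0 else 1)"

definition angle0 :: "bool \<Rightarrow> real" where "angle0 e = (if e then pi / 2 else 0)"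

text \<open>The integrand is the derivative of \<open>arctan (u / u')\<close>. Integrating it
  produces a continuous angle without any choice of branches; that it really is the polar angle is
  proved afterwards.\<close>

definition angle :: "bool \<Rightarrow> real \<Rightarrow> real \<Rightarrow> real \<Rightarrow> real" where
  "angle e l t x = angle0 e + integral {0..x}
     (\<lambda>s. ((du e l t s)\<^sup>2 - (W t s - l) * (u e l t s)\<^sup>2) / ((u e l t s)\<^sup>2 + (du e l t s)\<^sup>2))"

lemma sum_q: "(\<Sum>k\<le>r. q l t k * x ^ (2 * k)) = W t x - l"
proof -
  have "{..r} = insert 0 {1..r}" by auto
  then show ?thesis by (simp add: q_def W_def)
qed

lemma u_deriv: "(u e l t has_real_derivative du e l t x) (at x within A)"
  unfolding u_def du_def by (rule has_field_derivative_at_within, rule ode_sol_deriv) auto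

lemma du_deriv: "(du e l t has_real_derivative (W t x - l) * u e l t x) (at x within A)"
  unfolding u_def du_def sum_q[symmetric] by (rule has_field_derivative_at_within, rule ode_sol'_deriv) auto

lemma u_0: "u e l t 0 = (if e then 1 else 0)" "du e l t 0 = (if e then 0 else 1)"
  by (simp_all add: u_def du_def)

lemma u_minus: "u e l t (- x) = (if e then u e l t x else - u e l t x)"
  by (simp add: u_def ode_sol_minus)

lemma W_0: "W t 0 = 0"
  by (auto simp: W_def intro!: sum.neutral)

lemma continuous_on_q: "continuous_on UNIV (\<lambda>p. q (fst p) (snd p) k)"
  by (cases "k = 0") (auto simp: q_def intro!: continuous_intros)

lemma continuous_on_u: "continuous_on UNIV (\<lambda>(p, x). u e (fst p) (snd p) x)"
  unfolding u_def by (rule continuous_on_ode_sol) (auto intro: continuous_on_q)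

lemma continuous_on_du: "continuous_on UNIV (\<lambda>(p, x). du e (fst p) (snd p) x)"
  unfolding du_def by (rule continuous_on_ode_sol') (auto intro: continuous_on_q)

lemma continuous_on_W: "continuous_on A f \<Longrightarrow> continuous_on A g \<Longrightarrow> continuous_on A (\<lambda>x. W (f x) (g x))"
  unfolding W_def by (intro continuous_intros)

lemma continuous_on_u_x: "continuous_on A (u e l t)" "continuous_on A (du e l t)"
  by (meson DERIV_continuous_on u_deriv du_deriv)+

text \<open>The constant \<open>1\<close> has several uses: no solution vanishes together with its
  derivative, the two angles never differ by a multiple of \<open>pi\<close>, no value is an
  eigenvalue of both parities, and every solution is a combination of these two.\<close>

lemma wronskian: "u True l t x * du False l t x - du True l t x * u False l t x = 1"
proof -
  have "\<exists>c. \<forall>x\<in>UNIV. u True l t x * du False l t x - du True l t x * u False l t x = c"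
    by (rule has_field_derivative_zero_constant)
      (auto intro!: derivative_eq_intros u_deriv du_deriv)
  then obtain c where c: "\<And>x. u True l t x * du False l t x - du True l t x * u False l t x = c" by auto
  show ?thesis using c[of x] c[of 0] by (simp add: u_0)
qed

lemma u_nontrivial: "(u e l t x)\<^sup>2 + (du e l t x)\<^sup>2 > 0"
proof -
  have "u e l t x \<noteq> 0 \<or> du e l t x \<noteq> 0"
    using wronskian[of l t x] by (cases e) auto
  then show ?thesis by (simp add: sum_power2_gt_zero_iff)
qed

text \<open>The bound is \<open>2\<close> rather than \<open>0\<close> because the comparison with
  \<open>exp (- x)\<close> needs \<open>W - l - 1 \<ge> 1\<close>. Uniformity in \<open>l\<close>
  and \<open>t\<close> lets the same \<open>X\<close> serve all nearby parameters.\<close>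

lemma W_coercive:
  obtains X where "X \<ge> 1" "\<And>l t x. \<bar>t\<bar> \<le> T \<Longrightarrow> l \<le> L \<Longrightarrow> x \<ge> X \<Longrightarrow> W t x - l \<ge> 2"
proof -
  obtain A where A: "A \<ge> 1" "\<And>t x. \<bar>t\<bar> \<le> T \<Longrightarrow> x \<ge> A \<Longrightarrow>
      (\<Sum>k = 1..r. (2 * v k) * t ^ (r - k) * x ^ (2 * k)) \<ge> (2 * v r) / 2 * x ^ (2 * r)"
    using leading_term_dominates[of r "\<lambda>k. 2 * v k" T] vr r2
    by auto
  define X where "X = max A ((\<bar>L\<bar> + 2) / v r)"
  show ?thesis
  proof (rule that[of X])
    show "X \<ge> 1" using A(1) by (simp add: X_def)
    fix l t x :: real assume *: "\<bar>t\<bar> \<le> T" "l \<le> L" "x \<ge> X"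
    have x: "x \<ge> 1" using *(3) A(1) by (simp add: X_def)
    have "\<bar>L\<bar> + 2 \<le> v r * x" using *(3) vr by (simp add: X_def field_simps)
    also have "\<dots> \<le> v r * x ^ (2 * r)"
      using power_increasing[of 1 "2 * r" x] x r2 vr by (intro mult_left_mono) auto
    also have "\<dots> \<le> W t x" using A(2)[OF *(1), of x] *(3) by (simp add: X_def W_def)
    finally show "W t x - l \<ge> 2" using *(2) by simp
  qed
qed

lemma angle_deriv':
  assumes "x \<ge> 0" "A \<subseteq> {0..}"
  shows "(angle e l t has_real_derivative
      ((du e l t x)\<^sup>2 - (W t x - l) * (u e l t x)\<^sup>2) / ((u e l t x)\<^sup>2 + (du e l t x)\<^sup>2)) (at x within A)"
proof -
  let ?g = "\<lambda>x. ((du e l t x)\<^sup>2 - (W t x - l) * (u e l t x)\<^sup>2) / ((u e l t x)\<^sup>2 + (du e l t x)\<^sup>2)"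
  have "continuous_on {0..x + 1} ?g"
    using u_nontrivial less_imp_neq[OF u_nontrivial, symmetric]
    by (auto intro!: continuous_intros continuous_on_u_x continuous_on_W)
  then have "((\<lambda>x. integral {0..x} ?g) has_real_derivative ?g x) (at x within {0..x + 1})"
    using assms by (intro integral_has_real_derivative) auto
  then have "(angle e l t has_real_derivative ?g x) (at x within {0..x + 1})"
    unfolding angle_def[abs_def] by (auto intro!: derivative_eq_intros)
  also have "at x within {0..x + 1} = at x within {0..}"
    by (rule at_within_nhd[of x "{..<x + 1}"]) auto
  finally have "(angle e l t has_real_derivative ?g x) (at x within {0..})" .
  then show ?thesis using assms(2) by (rule DERIV_subset)
qed

lemma angle_0 [simp]: "angle e l t 0 = angle0 e"
  by (simp add: angle_def)

section \<open>Polar coordinates and the Pruefer equation\<close>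

definition rho :: "bool \<Rightarrow> real \<Rightarrow> real \<Rightarrow> real \<Rightarrow> real" where
  "rho e l t x = sqrt ((u e l t x)\<^sup>2 + (du e l t x)\<^sup>2)"

lemma rho_pos: "rho e l t x > 0"
  by (simp add: rho_def u_nontrivial)

lemma rho_sq: "(rho e l t x)\<^sup>2 = (u e l t x)\<^sup>2 + (du e l t x)\<^sup>2"
  by (simp add: rho_def)

lemma rho_deriv:
  "(rho e l t has_real_derivative (1 + (W t x - l)) * u e l t x * du e l t x / rho e l t x) (at x within A)"
proof -
  have "((\<lambda>x. sqrt ((u e l t x)\<^sup>2 + (du e l t x)\<^sup>2)) has_real_derivative
      (2 * (u e l t x * du e l t x) + 2 * (du e l t x * ((W t x - l) * u e l t x)))
        * (inverse (sqrt ((u e l t x)\<^sup>2 + (du e l t x)\<^sup>2)) / 2)) (at x within A)"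
    using u_nontrivial[of e l t x]
    by (auto intro!: derivative_eq_intros u_deriv du_deriv)
  moreover have "2 * (a * b) + 2 * (b * (Q * a)) = 2 * ((1 + Q) * a * b)" for a b Q :: real by algebra
  ultimately have "((\<lambda>x. sqrt ((u e l t x)\<^sup>2 + (du e l t x)\<^sup>2)) has_real_derivative
      2 * ((1 + (W t x - l)) * u e l t x * du e l t x)
        * (inverse (sqrt ((u e l t x)\<^sup>2 + (du e l t x)\<^sup>2)) / 2)) (at x within A)"
    by (simp only:)
  then show ?thesis
    unfolding rho_def[abs_def] by (rule DERIV_cong) (simp only: divide_inverse, simp)
qed

text \<open>The components \<open>a\<close> and \<open>b\<close> of the vector
  \<open>(u, u')\<close> in the frame rotated by the angle both satisfy the linear equation
  \<open>y' = \<kappa> * y\<close>, and so does \<open>rho\<close>. Hence their quotients by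
  \<open>rho\<close> are constant, and at the origin they are \<open>0\<close> and
  \<open>1\<close>.\<close>

lemma
  assumes "x \<ge> 0"
  shows u_polar: "u e l t x = rho e l t x * sin (angle e l t x)"
    and du_polar: "du e l t x = rho e l t x * cos (angle e l t x)"
proof -
  define \<theta>' where "\<theta>' = (\<lambda>x. ((du e l t x)\<^sup>2 - (W t x - l) * (u e l t x)\<^sup>2) / ((u e l t x)\<^sup>2 + (du e l t x)\<^sup>2))"
  define N where "N = (\<lambda>x. (1 + (W t x - l)) / (rho e l t x)\<^sup>2)"
  define \<kappa> where "\<kappa> = (\<lambda>x. N x * u e l t x * du e l t x)"
  define a where "a = (\<lambda>x. u e l t x * cos (angle e l t x) - du e l t x * sin (angle e l t x))"
  define b where "b = (\<lambda>x. u e l t x * sin (angle e l t x) + du e l t x * cos (angle e l t x))"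
  have angle: "(angle e l t has_real_derivative \<theta>' x) (at x within {0..})" if "x \<ge> 0" for x
    unfolding \<theta>'_def using that by (intro angle_deriv') auto
  have k1: "1 - \<theta>' x = N x * (u e l t x)\<^sup>2"
    and k2: "\<theta>' x + (W t x - l) = N x * (du e l t x)\<^sup>2" for x
  proof -
    have "1 - (b - Q * a) / (a + b) = (1 + Q) / (a + b) * a \<and> (b - Q * a) / (a + b) + Q = (1 + Q) / (a + b) * b"
      if "a + b > 0" for a b Q :: real
      using that by (simp add: divide_simps) (simp add: algebra_simps)
    from this[OF u_nontrivial] show "1 - \<theta>' x = N x * (u e l t x)\<^sup>2"
      "\<theta>' x + (W t x - l) = N x * (du e l t x)\<^sup>2"
      unfolding \<theta>'_def N_def rho_sq by blast+
  qed
  have rho: "(rho e l t has_real_derivative \<kappa> x * rho e l t x) (at x within {0..})" for x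
    using rho_deriv[of e l t x "{0..}"] rho_pos[of e l t x] by (simp add: \<kappa>_def N_def power2_eq_square)
  have da: "(a has_real_derivative \<kappa> x * a x) (at x within {0..})" if "x \<ge> 0" for x
  proof -
    have "(a has_real_derivative
        du e l t x * cos (angle e l t x) * (1 - \<theta>' x) - u e l t x * sin (angle e l t x) * (\<theta>' x + (W t x - l))) (at x within {0..})"
      unfolding a_def by (auto intro!: derivative_eq_intros u_deriv du_deriv angle that simp: algebra_simps)
    then show ?thesis
      unfolding k1 k2 by (rule DERIV_cong) (simp add: \<kappa>_def a_def algebra_simps power2_eq_square)
  qed
  have db: "(b has_real_derivative \<kappa> x * b x) (at x within {0..})" if "x \<ge> 0" for x
  proof -
    have "(b has_real_derivative
        du e l t x * sin (angle e l t x) * (1 - \<theta>' x) + u e l t x * cos (angle e l t x) * (\<theta>' x + (W t x - l))) (at x within {0..})"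
      unfolding b_def by (auto intro!: derivative_eq_intros u_deriv du_deriv angle that simp: algebra_simps)
    then show ?thesis
      unfolding k1 k2 by (rule DERIV_cong) (simp add: \<kappa>_def b_def algebra_simps power2_eq_square)
  qed
  have const: "f x / rho e l t x = f 0 / rho e l t 0"
    if "\<And>x. x \<ge> 0 \<Longrightarrow> (f has_real_derivative \<kappa> x * f x) (at x within {0..})" for f
  proof -
    have "\<exists>c. \<forall>x\<in>{0..}. f x / rho e l t x = c"
      using rho_pos[of e l t]
      by (intro has_field_derivative_zero_constant)
        (auto intro!: derivative_eq_intros rho that simp: less_imp_neq[symmetric])
    then show ?thesis using assms by auto
  qed
  have "a 0 = 0" "b 0 = rho e l t 0"
    by (cases e; simp add: a_def b_def u_0 angle0_def rho_def)+
  then have ab: "a x = 0" "b x = rho e l t x"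
    using const[of a, OF da] const[of b, OF db] rho_pos[of e l t x] rho_pos[of e l t 0] by (auto simp: field_simps)
  have sc: "(sin (angle e l t x))\<^sup>2 + (cos (angle e l t x))\<^sup>2 = 1" by simp
  have "u e l t x = a x * cos (angle e l t x) + b x * sin (angle e l t x)"
    unfolding a_def b_def using sc by algebra
  then show "u e l t x = rho e l t x * sin (angle e l t x)" by (simp add: ab)
  have "du e l t x = b x * cos (angle e l t x) - a x * sin (angle e l t x)"
    unfolding a_def b_def using sc by algebra
  then show "du e l t x = rho e l t x * cos (angle e l t x)" by (simp add: ab)
qed

text \<open>The amplitude drops out. The slope is \<open>1\<close> at multiples of \<open>pi\<close>
  and \<open>l - W\<close> at odd multiples of \<open>pi / 2\<close>, which is all that the crossing
  arguments use.\<close>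

lemma angle_deriv:
  assumes "x \<ge> 0" "A \<subseteq> {0..}"
  shows "(angle e l t has_real_derivative
      ((cos (angle e l t x))\<^sup>2 - (W t x - l) * (sin (angle e l t x))\<^sup>2)) (at x within A)"
proof -
  have "((du e l t x)\<^sup>2 - (W t x - l) * (u e l t x)\<^sup>2) / ((u e l t x)\<^sup>2 + (du e l t x)\<^sup>2)
      = (cos (angle e l t x))\<^sup>2 - (W t x - l) * (sin (angle e l t x))\<^sup>2"
    unfolding rho_sq[symmetric] unfolding u_polar[OF assms(1)] du_polar[OF assms(1)]
    using rho_pos[of e l t x] by (simp add: power_mult_distrib divide_simps) (simp add: algebra_simps)
  then show ?thesis using angle_deriv'[OF assms, of e l t] by simp
qed

lemma continuous_on_angle_x: "A \<subseteq> {0..} \<Longrightarrow> continuous_on A (angle e l t)"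
  by (rule DERIV_continuous_on[OF angle_deriv]) auto

lemma continuous_on_angle: "continuous_on UNIV (\<lambda>p. angle e (fst p) (snd p) x)"
proof -
  have 1: "continuous_on A (\<lambda>z. u e (fst (fst z)) (snd (fst z)) (snd z))"
    "continuous_on A (\<lambda>z. du e (fst (fst z)) (snd (fst z)) (snd z))" for A
    using continuous_on_subset[OF continuous_on_u] continuous_on_subset[OF continuous_on_du]
    by (auto simp: case_prod_unfold)
  have "continuous_on UNIV (\<lambda>p. integral (cbox 0 x)
     (\<lambda>s. ((du e (fst p) (snd p) s)\<^sup>2 - (W (snd p) s - fst p) * (u e (fst p) (snd p) s)\<^sup>2) / ((u e (fst p) (snd p) s)\<^sup>2 + (du e (fst p) (snd p) s)\<^sup>2)))"
    using less_imp_neq[OF u_nontrivial, symmetric]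
    by (intro integral_continuous_on_param) (auto simp: case_prod_unfold intro!: continuous_intros 1 continuous_on_W)
  then show ?thesis unfolding angle_def by (auto intro!: continuous_intros)
qed

lemma angle_tendsto: "((\<lambda>p. angle e (fst p) (snd p) x) \<longlongrightarrow> angle e l t x) (nhds (l, t))"
proof -
  have "isCont (\<lambda>p. angle e (fst p) (snd p) x) (l, t)"
    using continuous_on_angle by (simp add: continuous_on_eq_continuous_at)
  then show ?thesis
    using tendsto_at_iff_tendsto_nhds[of "\<lambda>p. angle e (fst p) (snd p) x" "(l, t)"] by (simp add: isCont_def)
qed

section \<open>Crossing, monotonicity and interlacing of angles\<close>

lemma angle_cross:
  assumes "0 \<le> x" "x \<le> y" "real j * pi \<le> angle e l t x"
  shows "real j * pi \<le> angle e l t y" "x < y \<Longrightarrow> real j * pi < angle e l t y"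
proof -
  have *: "(cos (angle e l t z))\<^sup>2 - (W t z - l) * (sin (angle e l t z))\<^sup>2 > 0" if "angle e l t z = real j * pi" for z
    unfolding that by simp
  show "real j * pi \<le> angle e l t y" "x < y \<Longrightarrow> real j * pi < angle e l t y"
    using assms * by (auto intro!: cross_up[of x y "angle e l t", OF _ angle_deriv])
qed

lemma angle_trap:
  assumes "0 \<le> x" "x \<le> y" "angle e l t x \<le> real j * pi + pi / 2"
    and Q: "\<And>z. x \<le> z \<Longrightarrow> z \<le> y \<Longrightarrow> W t z - l > 0"
  shows "angle e l t y \<le> real j * pi + pi / 2" "x < y \<Longrightarrow> angle e l t y < real j * pi + pi / 2"
proof -
  have *: "(cos (angle e l t z))\<^sup>2 - (W t z - l) * (sin (angle e l t z))\<^sup>2 < 0"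
    if "angle e l t z = real j * pi + pi / 2" "x \<le> z" "z \<le> y" for z
    using Q[OF that(2,3)] unfolding that(1) by (simp add: cos_add sin_add)
  show "angle e l t y \<le> real j * pi + pi / 2" "x < y \<Longrightarrow> angle e l t y < real j * pi + pi / 2"
    using assms * by (auto intro!: cross_down[of x y "angle e l t", OF _ angle_deriv])
qed

lemma angle_nonneg: "x \<ge> 0 \<Longrightarrow> angle e l t x \<ge> 0"
  using angle_cross(1)[of 0 x 0 e l t] by (simp add: angle0_def)

text \<open>The difference \<open>D\<close> of the angles starts at \<open>0\<close> and satisfies
  only \<open>D' \<ge> - L * \<bar>D\<bar>\<close>, which gives no strict sign at
  \<open>D = 0\<close>. A small exponential is therefore added to make the barrier argument
  strict.\<close>

lemma angle_mono:
  assumes "l \<le> l'" "x \<ge> 0"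
  shows "angle e l t x \<le> angle e l' t x"
proof -
  have "\<exists>L. \<forall>z\<in>{0..x}. \<bar>1 + W t z - l\<bar> \<le> L"
  proof -
    have "compact ((\<lambda>z. \<bar>1 + W t z - l\<bar>) ` {0..x})"
      by (intro compact_continuous_image continuous_intros continuous_on_W) auto
    then have "bdd_above ((\<lambda>z. \<bar>1 + W t z - l\<bar>) ` {0..x})"
      by (intro bounded_imp_bdd_above compact_imp_bounded)
    then show ?thesis by (auto simp: bdd_above_def)
  qed
  then obtain L0 where L0: "\<And>z. z \<in> {0..x} \<Longrightarrow> \<bar>1 + W t z - l\<bar> \<le> L0" by blast
  define L where "L = max L0 1"
  have L: "L > 0" "\<And>z. z \<in> {0..x} \<Longrightarrow> \<bar>1 + W t z - l\<bar> \<le> L" using L0 by (auto simp: L_def le_max_iff_disj)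
  define D where "D = (\<lambda>z. angle e l' t z - angle e l t z)"
  define D' where "D' = (\<lambda>z. - (1 + W t z - l) * ((sin (angle e l' t z))\<^sup>2 - (sin (angle e l t z))\<^sup>2) + (l' - l) * (sin (angle e l' t z))\<^sup>2)"
  have D: "(D has_real_derivative D' z) (at z within {0..x})" if "z \<in> {0..x}" for z
  proof -
    have "(D has_real_derivative ((cos (angle e l' t z))\<^sup>2 - (W t z - l') * (sin (angle e l' t z))\<^sup>2) -
        ((cos (angle e l t z))\<^sup>2 - (W t z - l) * (sin (angle e l t z))\<^sup>2)) (at z within {0..x})"
      unfolding D_def using that by (intro DERIV_diff angle_deriv) auto
    then show ?thesis
      by (rule DERIV_cong) (simp add: D'_def cos_squared_eq algebra_simps)
  qed
  have D'_ge: "D' z \<ge> - L * \<bar>D z\<bar>" if "z \<in> {0..x}" for z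
  proof -
    have "\<bar>(sin (angle e l' t z))\<^sup>2 - (sin (angle e l t z))\<^sup>2\<bar> = \<bar>sin (angle e l' t z + angle e l t z)\<bar> * \<bar>sin (D z)\<bar>"
    proof -
      have "(sin a)\<^sup>2 - (sin b)\<^sup>2 = sin (a + b) * sin (a - b)" for a b :: real
        using sin_cos_squared_add[of a] sin_cos_squared_add[of b] unfolding sin_add sin_diff by algebra
      then show ?thesis by (simp add: D_def abs_mult)
    qed
    also have "\<dots> \<le> 1 * \<bar>D z\<bar>" by (intro mult_mono abs_sin_le_one abs_sin_x_le_abs_x) auto
    finally have "\<bar>(1 + W t z - l) * ((sin (angle e l' t z))\<^sup>2 - (sin (angle e l t z))\<^sup>2)\<bar> \<le> L * \<bar>D z\<bar>"
      unfolding abs_mult using L that by (intro mult_mono) auto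
    moreover have "(l' - l) * (sin (angle e l' t z))\<^sup>2 \<ge> 0" using assms by simp
    ultimately show ?thesis unfolding D'_def mult_minus_left by linarith
  qed
  have "D x + \<epsilon> * exp (2 * L * x) \<ge> 0" if "\<epsilon> > 0" for \<epsilon>
  \<comment> \<open>The rate \<open>2 * L\<close> is twice the Lipschitz constant: where the sum
    vanishes, \<open>D'\<close> loses at most \<open>L * \<epsilon> * exp (2 * L * z)\<close>, while
    the added term gains twice as much.\<close>
  proof (rule cross_up(1)[of 0 x "\<lambda>z. D z + \<epsilon> * exp (2 * L * z)" "\<lambda>z. D' z + \<epsilon> * (exp (2 * L * z) * (2 * L))"])
    show "0 \<le> x" by fact
    show "0 \<le> D 0 + \<epsilon> * exp (2 * L * 0)" using that by (simp add: D_def)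
    fix z assume z: "z \<in> {0..x}"
    show "((\<lambda>z. D z + \<epsilon> * exp (2 * L * z)) has_real_derivative D' z + \<epsilon> * (exp (2 * L * z) * (2 * L))) (at z within {0..x})"
      by (auto intro!: derivative_eq_intros D z)
    assume "D z + \<epsilon> * exp (2 * L * z) = 0"
    moreover have "\<epsilon> * exp (2 * L * z) > 0" using that by simp
    ultimately have "\<bar>D z\<bar> = \<epsilon> * exp (2 * L * z)" by linarith
    then have "D' z \<ge> - (L * (\<epsilon> * exp (2 * L * z)))" using D'_ge[OF z] by simp
    moreover have "L * (\<epsilon> * exp (2 * L * z)) > 0" using L that by simp
    ultimately show "D' z + \<epsilon> * (exp (2 * L * z) * (2 * L)) > 0" by (simp add: algebra_simps)
  qed
  then have "D x + \<epsilon> \<ge> 0" if "\<epsilon> > 0" for \<epsilon>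
    using that \<open>\<And>\<epsilon>. \<epsilon> > 0 \<Longrightarrow> D x + \<epsilon> * exp (2 * L * x) \<ge> 0\<close>[of "\<epsilon> / exp (2 * L * x)"] by simp
  then have "D x \<ge> 0" by (rule field_le_epsilon)
  then show ?thesis by (simp add: D_def)
qed

text \<open>In polar form the Wronskian identity says that the sine of the angle difference never
  vanishes. The difference starts at \<open>pi / 2\<close>, so by continuity it stays strictly
  between \<open>0\<close> and \<open>pi\<close>.\<close>

lemma angle_interlace:
  assumes "x \<ge> 0"
  shows "angle False l t x < angle True l t x" "angle True l t x < angle False l t x + pi"
proof -
  define D where "D = (\<lambda>x. angle True l t x - angle False l t x)"
  have nz: "D z \<noteq> 0 \<and> D z \<noteq> pi" if "z \<ge> 0" for z
  proof -
    have "rho True l t z * rho False l t z * sin (D z) = 1"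
      using wronskian[of l t z] by (simp add: D_def sin_diff u_polar du_polar that algebra_simps)
    then show ?thesis by auto
  qed
  have cont: "continuous_on {0..x} D"
    unfolding D_def by (intro continuous_intros continuous_on_angle_x) auto
  have D0: "D 0 = pi / 2" by (simp add: D_def angle0_def)
  have "D x > 0"
    using IVT2'[of D x 0 0] nz cont D0 assms by (metis divide_pos_pos less_imp_le not_le pi_gt_zero zero_less_numeral)
  moreover have "D x < pi"
    using IVT'[of D 0 pi x] nz cont D0 assms pi_half_le_two pi_gt_zero by (smt (verit) field_sum_of_halves)
  ultimately show "angle False l t x < angle True l t x" "angle True l t x < angle False l t x + pi"
    by (auto simp: D_def)
qed

end

section \<open>Eigenvalues as thresholds of the Pruefer angle\<close>

context anharmonic
begin

text \<open>This set is open and, by \<open>angle_mono\<close>, upward closed, so it does not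
  contain its infimum. The level is \<open>Suc k\<close> because the even angle starts at
  \<open>pi / 2\<close> and the odd one at \<open>0\<close>: \<open>pi\<close> is the first level
  that either can approach from below at infinity.\<close>

definition reach :: "bool \<Rightarrow> nat \<Rightarrow> real \<Rightarrow> real set" where
  "reach e k t = {l. \<exists>x\<ge>0. real (Suc k) * pi \<le> angle e l t x}"

definition parity_eigval :: "bool \<Rightarrow> nat \<Rightarrow> real \<Rightarrow> real" where
  "parity_eigval e k t = Inf (reach e k t)"

text \<open>
  For large \<open>x\<close> the angle approaches a multiple of \<open>pi\<close>: from below if \<open>u\<close> and \<open>u'\<close> have opposite signs,
  so that \<open>u\<close> decays, and from above if \<open>u\<close> blows up.
\<close>

definition decaying :: "bool \<Rightarrow> real \<Rightarrow> real \<Rightarrow> nat \<Rightarrow> bool" where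
  "decaying e l t j \<longleftrightarrow> (\<forall>\<^sub>F x in at_top. real j * pi - pi / 2 < angle e l t x \<and> angle e l t x < real j * pi)"

definition growing :: "bool \<Rightarrow> real \<Rightarrow> real \<Rightarrow> nat \<Rightarrow> bool" where
  "growing e l t j \<longleftrightarrow> (\<forall>\<^sub>F x in at_top. real j * pi < angle e l t x \<and> angle e l t x < real j * pi + pi / 2)"

lemma eventually_sample:
  fixes y :: real
  assumes "\<forall>\<^sub>F x in at_top. P x"
  obtains x where "x \<ge> y" "P x"
proof -
  have "\<forall>\<^sub>F x in at_top. x \<ge> y \<and> P x" using assms by (intro eventually_conj eventually_ge_at_top)
  then show thesis using that by (metis (mono_tags, lifting) eventually_happens trivial_limit_at_top_linorder)
qed

text \<open>Where \<open>W > l\<close>, each interval from \<open>j * pi\<close> to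
  \<open>j * pi + pi / 2\<close> is a trap, left neither through its lower end, which is crossed
  only upwards, nor through its upper end, which is crossed only downwards. An angle that meets a
  trap beyond \<open>X\<close> stays in it and is growing; otherwise it is confined between two
  consecutive traps and is decaying.\<close>

lemma decaying_or_growing: "\<exists>j. decaying e l t j \<or> growing e l t j"
proof -
  obtain X where X: "X \<ge> 1" "\<And>l' t' x. \<bar>t'\<bar> \<le> \<bar>t\<bar> \<Longrightarrow> l' \<le> l \<Longrightarrow> x \<ge> X \<Longrightarrow> W t' x - l' \<ge> 2"
    using W_coercive[where T = "\<bar>t\<bar>" and L = l] by blast
  have Q: "W t x - l > 0" if "x \<ge> X" for x using X(2)[of t l x] that by simp
  show ?thesis
  proof (cases "\<exists>y\<ge>X. \<exists>j. real j * pi \<le> angle e l t y \<and> angle e l t y \<le> real j * pi + pi / 2")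
    case True
    then obtain y j where y: "y \<ge> X" "real j * pi \<le> angle e l t y" "angle e l t y \<le> real j * pi + pi / 2" by blast
    have "real j * pi < angle e l t x \<and> angle e l t x < real j * pi + pi / 2" if "x > y" for x
      using angle_cross(2)[of y x j e l t] angle_trap(2)[of y x e l t j] Q X(1) y that by auto
    then have "growing e l t j"
      unfolding growing_def by (intro eventually_mono[OF eventually_gt_at_top[of y]]) auto
    then show ?thesis by blast
  next
    case False
    define n where "n = nat \<lfloor>angle e l t X / pi\<rfloor>"
    have "angle e l t X \<ge> 0" using X(1) by (intro angle_nonneg) auto
    then have "real n = of_int \<lfloor>angle e l t X / pi\<rfloor>" by (simp add: n_def)
    then have "real n \<le> angle e l t X / pi" "angle e l t X / pi < real n + 1" by linarith+
    then have n: "real n * pi \<le> angle e l t X" "angle e l t X < real n * pi + pi"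
      by (simp_all add: pos_le_divide_eq pos_divide_less_eq algebra_simps)
    have no: "\<not> (real j * pi \<le> angle e l t x \<and> angle e l t x \<le> real j * pi + pi / 2)" if "x \<ge> X" for x j
      using False that by blast
    have "real (Suc n) * pi - pi / 2 < angle e l t x \<and> angle e l t x < real (Suc n) * pi" if "x \<ge> X" for x
    proof -
      have "real n * pi \<le> angle e l t x"
        using angle_cross(1)[of X x n e l t] X(1) n that by auto
      moreover have "angle e l t x \<le> real (Suc n) * pi + pi / 2"
      proof (rule angle_trap(1)[of X])
        show "angle e l t X \<le> real (Suc n) * pi + pi / 2"
          using n(2) pi_gt_zero unfolding of_nat_Suc distrib_right by linarith
      qed (use X(1) that Q in auto)
      ultimately show ?thesis
        using no[OF that, of n] no[OF that, of "Suc n"] unfolding of_nat_Suc distrib_right by linarith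
    qed
    then have "decaying e l t (Suc n)"
      unfolding decaying_def by (intro eventually_mono[OF eventually_ge_at_top[of X]]) auto
    then show ?thesis by blast
  qed
qed

lemma decaying_less:
  assumes "decaying e l t j" "x \<ge> 0"
  shows "angle e l t x < real j * pi"
proof (rule ccontr)
  assume "\<not> angle e l t x < real j * pi"
  moreover obtain y where "y \<ge> x" "angle e l t y < real j * pi"
    using assms(1) unfolding decaying_def by (rule eventually_sample) auto
  ultimately show False using angle_cross(1)[of x y j e l t] assms(2) by auto
qed

lemma decaying_pos: "decaying e l t j \<Longrightarrow> \<exists>k. j = Suc k"
  using decaying_less[of e l t j 0] angle_nonneg[of 0 e l t] by (cases j) auto

lemma reach_I: "x \<ge> 0 \<Longrightarrow> real (Suc k) * pi \<le> angle e l t x \<Longrightarrow> l \<in> reach e k t"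
  unfolding reach_def by blast

lemma reach_E:
  assumes "l \<in> reach e k t"
  obtains x where "x \<ge> 0" "real (Suc k) * pi \<le> angle e l t x"
  using assms unfolding reach_def by blast

lemma not_reach_D: "l \<notin> reach e k t \<Longrightarrow> x \<ge> 0 \<Longrightarrow> angle e l t x < real (Suc k) * pi"
  using reach_I not_le by blast

lemma reach_up: "l \<in> reach e k t \<Longrightarrow> l \<le> l' \<Longrightarrow> l' \<in> reach e k t"
  using angle_mono[of l l'] order_trans by (elim reach_E) (blast intro: reach_I)

lemma reach_near:
  assumes "l \<in> reach e k t"
  shows "\<forall>\<^sub>F p in nhds (l, t). fst p \<in> reach e k (snd p)"
proof -
  obtain x where x: "x \<ge> 0" "real (Suc k) * pi \<le> angle e l t x" using assms by (rule reach_E)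
  \<comment> \<open>Moving on from \<open>x\<close> to \<open>x + 1\<close> makes the inequality
    strict, so it survives a small change of \<open>(l, t)\<close>.\<close>
  then have "real (Suc k) * pi < angle e l t (x + 1)" using angle_cross(2)[of x "x + 1" "Suc k"] by simp
  then have "\<forall>\<^sub>F p in nhds (l, t). real (Suc k) * pi < angle e (fst p) (snd p) (x + 1)"
    by (rule order_tendstoD(1)[OF angle_tendsto])
  then show ?thesis
    by eventually_elim (rule reach_I[of "x + 1"], use x in auto)
qed

text \<open>The trap caps the angle beyond \<open>y\<close>. Smaller arguments are covered too,
  since a level once reached is never lost.\<close>

lemma not_in_reach:
  assumes y: "y \<ge> 0" "angle e l t y \<le> real j * pi + pi / 2" "\<And>z. z \<ge> y \<Longrightarrow> W t z - l > 0" and "j \<le> k"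
  shows "l \<notin> reach e k t"
proof
  assume "l \<in> reach e k t"
  then obtain x where x: "x \<ge> 0" "real (Suc k) * pi \<le> angle e l t x" by (rule reach_E)
  define z where "z = max x y"
  have "real (Suc k) * pi \<le> angle e l t z" using angle_cross(1)[of x z "Suc k"] x by (simp add: z_def)
  moreover have "angle e l t z \<le> real j * pi + pi / 2" 
    by (rule angle_trap(1)[OF y(1) _ y(2)]) (use y(3) in \<open>simp_all add: z_def\<close>)
  moreover have "real j * pi \<le> real k * pi" using \<open>j \<le> k\<close> by (intro mult_right_mono) auto
  moreover have "real (Suc k) * pi = real k * pi + pi" by (simp add: algebra_simps)
  ultimately show False using pi_gt_zero by linarith
qed

text \<open>Apart from decay towards \<open>(k + 1) * pi\<close> itself, an angle that stays below
  this level ends up below \<open>j * pi + pi / 2\<close> for some \<open>j \<le> k\<close>. This is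
  a strict inequality at a single point \<open>y\<close> in the trapping region, hence stable under
  perturbation.\<close>

lemma not_in_reach_near:
  assumes "l \<notin> reach e k t" "\<not> decaying e l t (Suc k)"
  shows "\<forall>\<^sub>F p in nhds (l, t). fst p \<notin> reach e k (snd p)"
proof -
  have lt: "angle e l t x < real (Suc k) * pi" if "x \<ge> 0" for x
    using assms(1) that by (rule not_reach_D)
  obtain j where j: "j \<le> k" "\<forall>\<^sub>F x in at_top. angle e l t x < real j * pi + pi / 2"
  proof -
    obtain j where "decaying e l t j \<or> growing e l t j" using decaying_or_growing by blast
    then show thesis
    proof
      assume b: "decaying e l t j"
      then obtain x where "x \<ge> 0" "real j * pi - pi / 2 < angle e l t x"
        unfolding decaying_def by (rule eventually_sample) auto
      then have "real j * pi - pi / 2 < real (Suc k) * pi" using lt[of x] by (meson less_trans)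
      then have "(real j - 1 / 2) * pi < real (Suc k) * pi" unfolding left_diff_distrib by simp
      then have "real j - 1 / 2 < real (Suc k)" by (simp only: mult_less_cancel_right_pos[OF pi_gt_zero])
      then have "j \<le> Suc k" by linarith
      moreover have "j \<noteq> Suc k" using b assms(2) by auto
      ultimately have "j \<le> k" by simp
      moreover have "\<forall>\<^sub>F x in at_top. angle e l t x < real j * pi + pi / 2"
        using b unfolding decaying_def by eventually_elim (use pi_gt_zero in linarith)
      ultimately show thesis by (rule that)
    next
      assume g: "growing e l t j"
      then obtain x where "x \<ge> 0" "real j * pi < angle e l t x"
        unfolding growing_def by (rule eventually_sample) auto
      then have "real j * pi < real (Suc k) * pi" using lt[of x] by (meson less_trans)
      then have "real j < real (Suc k)" by (simp only: mult_less_cancel_right_pos[OF pi_gt_zero])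
      then have "j \<le> k" by simp
      moreover have "\<forall>\<^sub>F x in at_top. angle e l t x < real j * pi + pi / 2"
        using g unfolding growing_def by eventually_elim auto
      ultimately show thesis by (rule that)
    qed
  qed
  \<comment> \<open>The margins of \<open>1\<close> make the trap beyond \<open>X\<close> effective
    for all parameters near \<open>(l, t)\<close>.\<close>
  obtain X where X: "X \<ge> 1" "\<And>l' t' x. \<bar>t'\<bar> \<le> \<bar>t\<bar> + 1 \<Longrightarrow> l' \<le> l + 1 \<Longrightarrow> x \<ge> X \<Longrightarrow> W t' x - l' \<ge> 2"
    using W_coercive[where T = "\<bar>t\<bar> + 1" and L = "l + 1"] by blast
  obtain y where y: "y \<ge> X" "angle e l t y < real j * pi + pi / 2"
    using j(2) by (rule eventually_sample) auto
  have 1: "\<forall>\<^sub>F p in nhds (l, t). angle e (fst p) (snd p) y < real j * pi + pi / 2"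
    by (rule order_tendstoD(2)[OF angle_tendsto y(2)])
  have f: "(fst \<longlongrightarrow> l) (nhds (l, t))" "(snd \<longlongrightarrow> t) (nhds (l, t))"
    using tendsto_fst[OF filterlim_ident[of "nhds (l, t)"]] tendsto_snd[OF filterlim_ident[of "nhds (l, t)"]] by simp_all
  have 2: "\<forall>\<^sub>F p in nhds (l, t). fst p < l + 1"
    by (rule order_tendstoD(2)[OF f(1)]) simp
  have 3: "\<forall>\<^sub>F p in nhds (l, t). \<bar>snd p\<bar> < \<bar>t\<bar> + 1"
    by (rule order_tendstoD(2)[OF tendsto_rabs[OF f(2)]]) simp
  from 1 2 3 show ?thesis
  proof eventually_elim
    case (elim p)
    have "W (snd p) z - fst p > 0" if "z \<ge> y" for z
      using X(2)[of "snd p" "fst p" z] elim that y by simp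
    then show ?case
      using not_in_reach[of y e "fst p" "snd p" j k] elim(1) y X(1) j(1) by auto
  qed
qed

lemma angle_deriv_at:
  assumes "x > 0"
  shows "(angle e l t has_real_derivative ((cos (angle e l t x))\<^sup>2 - (W t x - l) * (sin (angle e l t x))\<^sup>2)) (at x)"
proof -
  have "at x within {0..} = at x"
    using assms by (intro at_within_interior) (simp add: interior_real_atLeast)
  then show ?thesis using angle_deriv[of x "{0..}" e l t] assms by simp
qed

lemma reach_nonempty: "reach e k t \<noteq> {}"
proof -
  define R where "R = real (Suc k) * pi"
  have R: "R > 0" by (simp add: R_def)
  have "compact (W t ` {0..R})"
    by (intro compact_continuous_image continuous_on_W continuous_intros) auto
  then have "bdd_above (W t ` {0..R})"
    by (intro bounded_imp_bdd_above compact_imp_bounded)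
  then obtain B where B: "\<And>x. x \<in> {0..R} \<Longrightarrow> W t x \<le> B"
    unfolding bdd_above_def by blast
  \<comment> \<open>With \<open>l\<close> exceeding \<open>W\<close> by at least \<open>1\<close> on
    the interval, the angle has slope at least \<open>1\<close> there and gains at least
    \<open>R\<close>.\<close>
  define l where "l = B + 1"
  have "angle e l t 0 - 0 \<le> angle e l t R - R"
  proof (rule DERIV_nonneg_imp_increasing_open[of 0 R "\<lambda>x. angle e l t x - x"])
    fix x assume x: "0 < x" "x < R"
    have "(cos (angle e l t x))\<^sup>2 + (l - W t x) * (sin (angle e l t x))\<^sup>2 \<ge> (cos (angle e l t x))\<^sup>2 + 1 * (sin (angle e l t x))\<^sup>2"
      using B[of x] x by (intro add_left_mono mult_right_mono) (auto simp: l_def)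
    then have "(cos (angle e l t x))\<^sup>2 - (W t x - l) * (sin (angle e l t x))\<^sup>2 - 1 \<ge> 0"
      by (simp add: algebra_simps)
    then show "\<exists>y. ((\<lambda>x. angle e l t x - x) has_real_derivative y) (at x) \<and> 0 \<le> y"
      using DERIV_diff[OF angle_deriv_at[OF x(1), of e l t] DERIV_ident] by blast
  qed (use R in \<open>auto intro!: continuous_intros continuous_on_angle_x\<close>)
  then have "R \<le> angle e l t R" using angle_nonneg[of 0 e l t] by simp
  then have "l \<in> reach e k t" using R by (intro reach_I[of R]) (auto simp: R_def)
  then show ?thesis by auto
qed

lemma reach_bdd_below: "bdd_below (reach e k t)"
proof -
  obtain X where X: "X \<ge> 1" "\<And>l' t' x. \<bar>t'\<bar> \<le> \<bar>t\<bar> \<Longrightarrow> l' \<le> 0 \<Longrightarrow> x \<ge> X \<Longrightarrow> W t' x - l' \<ge> 2"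
    using W_coercive[where T = "\<bar>t\<bar>" and L = 0] by blast
  have "compact (W t ` {0..X})"
    by (intro compact_continuous_image continuous_on_W continuous_intros) auto
  then have "bdd_below (W t ` {0..X})"
    by (intro bounded_imp_bdd_below compact_imp_bounded)
  then obtain B where B: "\<And>x. x \<in> {0..X} \<Longrightarrow> B \<le> W t x"
    unfolding bdd_below_def by blast
  \<comment> \<open>This value lies below the potential on the whole half line, so the trap with
    \<open>j = 0\<close> acts from the origin on, and both initial angles are at most
    \<open>pi / 2\<close>.\<close>
  have "min B 0 - 1 \<notin> reach e k t"
  proof (rule not_in_reach[of 0 _ _ _ 0])
    fix z :: real assume z: "z \<ge> 0"
    show "W t z - (min B 0 - 1) > 0"
    proof (cases "z \<le> X")
      case True
      then show ?thesis using B[of z] z by simp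
    next
      case False
      then have "W t z - (min B 0 - 1) \<ge> 2" by (intro X(2)) auto
      then show ?thesis by linarith
    qed
  qed (auto simp: angle0_def)
  then have "min B 0 - 1 \<le> l" if "l \<in> reach e k t" for l
    using reach_up[OF that, of "min B 0 - 1"] by linarith
  then show ?thesis by (auto simp: bdd_below_def)
qed

lemma parity_eigval_le: "l \<in> reach e k t \<Longrightarrow> parity_eigval e k t \<le> l"
  unfolding parity_eigval_def by (rule cInf_lower[OF _ reach_bdd_below])

lemma parity_eigval_less: "parity_eigval e k t < l \<Longrightarrow> l \<in> reach e k t"
  unfolding parity_eigval_def using cInf_lessD[OF reach_nonempty] reach_up less_imp_le by blast

lemma eventually_nhds_slice:
  assumes "\<forall>\<^sub>F p in nhds (l, t). P (fst p) (snd p)"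
  shows "\<forall>\<^sub>F l' in nhds l. P l' t" "\<forall>\<^sub>F t' in nhds t. P l t'"
proof -
  have "((\<lambda>l'. (l', t)) \<longlongrightarrow> (l, t)) (nhds l)" "((\<lambda>t'. (l, t')) \<longlongrightarrow> (l, t)) (nhds t)"
    by (auto intro!: tendsto_intros filterlim_ident)
  then show "\<forall>\<^sub>F l' in nhds l. P l' t" "\<forall>\<^sub>F t' in nhds t. P l t'"
    using assms by (auto simp: filterlim_iff)
qed

lemma parity_eigval_not_in_reach: "parity_eigval e k t \<notin> reach e k t"
proof
  assume "parity_eigval e k t \<in> reach e k t"
  then have "\<forall>\<^sub>F l in nhds (parity_eigval e k t). l \<in> reach e k t"
    using eventually_nhds_slice(1)[where l = "parity_eigval e k t" and t = t and P = "\<lambda>l t. l \<in> reach e k t"] reach_near by simp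
  then obtain d where d: "d > 0" "\<And>l. dist l (parity_eigval e k t) < d \<Longrightarrow> l \<in> reach e k t"
    unfolding eventually_nhds_metric by blast
  then have "parity_eigval e k t - d / 2 \<in> reach e k t" by (simp add: dist_real_def)
  then show False using parity_eigval_le[of "parity_eigval e k t - d / 2" e k t] d(1) by simp
qed

text \<open>The infimum is outside \<open>reach\<close>. Without decay at this level, slightly
  larger values would be outside as well, contrary to being an infimum.\<close>

lemma decaying_parity_eigval: "decaying e (parity_eigval e k t) t (Suc k)"
proof (rule ccontr)
  assume "\<not> decaying e (parity_eigval e k t) t (Suc k)"
  then have "\<forall>\<^sub>F l in nhds (parity_eigval e k t). l \<notin> reach e k t"
    using eventually_nhds_slice(1)[where l = "parity_eigval e k t" and t = t and P = "\<lambda>l t. l \<notin> reach e k t"] not_in_reach_near parity_eigval_not_in_reach by simp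
  then obtain d where d: "d > 0" "\<And>l. dist l (parity_eigval e k t) < d \<Longrightarrow> l \<notin> reach e k t"
    unfolding eventually_nhds_metric by blast
  then have "parity_eigval e k t + d / 2 \<notin> reach e k t" by (simp add: dist_real_def)
  then show False using parity_eigval_less[of e k t "parity_eigval e k t + d / 2"] d(1) by simp
qed

section \<open>Exponential decay and uniqueness of the thresholds\<close>

lemma u_du: "x \<ge> 0 \<Longrightarrow> u e l t x * du e l t x = (rho e l t x)\<^sup>2 * sin (2 * angle e l t x) / 2"
  unfolding sin_double by (simp add: u_polar du_polar power2_eq_square)

lemma sin_double_shift: "sin (2 * y) = sin (2 * (y - real j * pi))"
proof -
  have "sin (2 * (y - real j * pi)) = sin (2 * y - real (2 * j) * pi)" by (simp add: algebra_simps)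
  also have "\<dots> = sin (2 * y)" unfolding sin_diff sin_npi cos_npi by simp
  finally show ?thesis by simp
qed

lemma decaying_decreasing:
  assumes "decaying e l t j"
  shows "\<forall>\<^sub>F x in at_top. u e l t x * du e l t x < 0"
  using assms[unfolded decaying_def] eventually_ge_at_top[of 0]
proof eventually_elim
  case (elim x)
  have "sin (2 * (angle e l t x - real j * pi)) < 0"
    using elim sin_gt_zero[of "- (2 * (angle e l t x - real j * pi))"] unfolding sin_minus by simp
  then have "(rho e l t x)\<^sup>2 * sin (2 * angle e l t x) < 0"
    unfolding sin_double_shift[of _ j, symmetric] using rho_pos[of e l t x] by (intro mult_pos_neg) auto
  then show ?case using elim(2) by (simp add: u_du)
qed

lemma growing_increasing:
  assumes "growing e l t j"
  shows "\<forall>\<^sub>F x in at_top. u e l t x * du e l t x > 0"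
  using assms[unfolded growing_def] eventually_ge_at_top[of 0]
proof eventually_elim
  case (elim x)
  have "sin (2 * (angle e l t x - real j * pi)) > 0"
    using elim by (intro sin_gt_zero) auto
  then have "(rho e l t x)\<^sup>2 * sin (2 * angle e l t x) > 0"
    unfolding sin_double_shift[of _ j, symmetric] using rho_pos[of e l t x] by (intro mult_pos_pos) auto
  then show ?case using elim(2) by (simp add: u_du)
qed

text \<open>Since \<open>u^2 * exp (2 * x)\<close> has derivative
  \<open>2 * h * exp (2 * x)\<close>, exponential decay amounts to \<open>h \<le> 0\<close>. Beyond
  \<open>X\<close> the function \<open>h\<close> is nondecreasing because
  \<open>W - l \<ge> 2\<close>. For \<open>u'\<close> boundedness is enough, since it later occurs
  only multiplied by a decaying solution or as a nonnegative square.\<close>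

lemma decaying_decay:
  assumes "decaying e l t j"
  shows "\<exists>K. \<forall>\<^sub>F x in at_top. \<bar>u e l t x\<bar> \<le> K * exp (- x) \<and> \<bar>du e l t x\<bar> \<le> K"
proof -
  obtain X0 where X0: "X0 \<ge> 1" "\<And>l' t' x. \<bar>t'\<bar> \<le> \<bar>t\<bar> \<Longrightarrow> l' \<le> l \<Longrightarrow> x \<ge> X0 \<Longrightarrow> W t' x - l' \<ge> 2"
    using W_coercive[where T = "\<bar>t\<bar>" and L = l] by blast
  obtain X1 where X1: "\<And>x. x \<ge> X1 \<Longrightarrow> u e l t x * du e l t x < 0"
    using decaying_decreasing[OF assms] unfolding eventually_at_top_linorder by blast
  define X where "X = max X0 X1"
  have Q: "W t x - l \<ge> 2" if "x \<ge> X" for x using X0(2)[of t l x] that by (simp add: X_def)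
  have neg: "u e l t x * du e l t x < 0" if "x \<ge> X" for x using X1 that by (simp add: X_def)
  define h where "h = (\<lambda>x. u e l t x * du e l t x + (u e l t x)\<^sup>2)"
  have h: "(h has_real_derivative (u e l t x + du e l t x)\<^sup>2 + (W t x - l - 1) * (u e l t x)\<^sup>2) (at x)" for x
    unfolding h_def by (auto intro!: derivative_eq_intros u_deriv du_deriv simp: algebra_simps power2_eq_square)
  have h_mono: "h x \<le> h y" if "X \<le> x" "x \<le> y" for x y
  proof (rule DERIV_nonneg_imp_nondecreasing[OF that(2)])
    fix z assume "x \<le> z" "z \<le> y"
    then have "(u e l t z + du e l t z)\<^sup>2 + (W t z - l - 1) * (u e l t z)\<^sup>2 \<ge> 0" using Q[of z] that by simp
    then show "\<exists>d. (h has_real_derivative d) (at z) \<and> 0 \<le> d" using h by blast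
  qed
  have u2_anti: "(u e l t y)\<^sup>2 \<le> (u e l t x)\<^sup>2" if "X \<le> x" "x \<le> y" for x y
  proof (rule DERIV_nonpos_imp_nonincreasing[OF that(2)])
    fix z assume z: "x \<le> z" "z \<le> y"
    have "((\<lambda>x. (u e l t x)\<^sup>2) has_real_derivative 2 * (u e l t z * du e l t z)) (at z)"
      by (auto intro!: derivative_eq_intros u_deriv)
    then show "\<exists>d. ((\<lambda>x. (u e l t x)\<^sup>2) has_real_derivative d) (at z) \<and> d \<le> 0"
      using neg[of z] z that by (intro exI[of _ "2 * (u e l t z * du e l t z)"] conjI) linarith+
  qed
  have du2_anti: "(du e l t y)\<^sup>2 \<le> (du e l t x)\<^sup>2" if "X \<le> x" "x \<le> y" for x y
  proof (rule DERIV_nonpos_imp_nonincreasing[OF that(2)])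
    fix z assume z: "x \<le> z" "z \<le> y"
    have "((\<lambda>x. (du e l t x)\<^sup>2) has_real_derivative 2 * ((W t z - l) * (u e l t z * du e l t z))) (at z)"
      by (auto intro!: derivative_eq_intros du_deriv)
    moreover have "(W t z - l) * (u e l t z * du e l t z) \<le> 0"
      using neg[of z] Q[of z] z that by (intro mult_nonneg_nonpos[of "W t z - l"]) linarith+
    ultimately show "\<exists>d. ((\<lambda>x. (du e l t x)\<^sup>2) has_real_derivative d) (at z) \<and> d \<le> 0"
      by (intro exI[of _ "2 * ((W t z - l) * (u e l t z * du e l t z))"] conjI) linarith+
  qed
  \<comment> \<open>Otherwise \<open>h\<close> would grow at least linearly, although it is bounded by \<open>u\<^sup>2\<close>.\<close>
  have h_nonpos: "h x \<le> 0" if x: "x \<ge> X" for x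
  proof (rule ccontr)
    assume "\<not> h x \<le> 0"
    then have \<eta>: "h x > 0" by simp
    \<comment> \<open>Chosen so that growth with slope \<open>h x\<close> gives
      \<open>h y \<ge> h x + u(X)^2\<close>, beyond the upper bound \<open>u(X)^2\<close>.\<close>
    define y where "y = x + (u e l t X)\<^sup>2 / h x"
    have y: "y \<ge> x" using \<eta> by (simp add: y_def)
    have le: "h z \<le> (u e l t z)\<^sup>2" if "z \<ge> X" for z using neg[OF that] by (simp add: h_def)
    have "h x - h x * x \<le> h y - h x * y"
    proof (rule DERIV_nonneg_imp_nondecreasing[OF y])
      fix z assume z: "x \<le> z" "z \<le> y"
      have "((\<lambda>z. h z - h x * z) has_real_derivative (u e l t z + du e l t z)\<^sup>2 + (W t z - l - 1) * (u e l t z)\<^sup>2 - h x) (at z)"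
        by (auto intro!: derivative_eq_intros h)
      moreover have "h x \<le> 1 * (u e l t z)\<^sup>2" using h_mono[of x z] le[of z] x z by simp
      moreover have "1 * (u e l t z)\<^sup>2 \<le> (W t z - l - 1) * (u e l t z)\<^sup>2"
        using Q[of z] x z by (intro mult_right_mono) auto
      moreover have "(u e l t z + du e l t z)\<^sup>2 \<ge> 0" by simp
      ultimately show "\<exists>d. ((\<lambda>z. h z - h x * z) has_real_derivative d) (at z) \<and> 0 \<le> d"
        by (intro exI[of _ "(u e l t z + du e l t z)\<^sup>2 + (W t z - l - 1) * (u e l t z)\<^sup>2 - h x"] conjI) linarith+
    qed
    moreover have "h x * y = h x * x + (u e l t X)\<^sup>2" using \<eta> by (simp add: y_def field_simps)
    moreover have "h y \<le> (u e l t X)\<^sup>2" using le[of y] u2_anti[of X y] x y by simp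
    ultimately show False using \<eta> by simp
  qed
  have ue: "(u e l t x)\<^sup>2 * exp (2 * x) \<le> (u e l t X)\<^sup>2 * exp (2 * X)" if "x \<ge> X" for x
  proof (rule DERIV_nonpos_imp_nonincreasing[OF that])
    fix z assume z: "X \<le> z" "z \<le> x"
    have "((\<lambda>x. (u e l t x)\<^sup>2 * exp (2 * x)) has_real_derivative 2 * h z * exp (2 * z)) (at z)"
      unfolding h_def by (auto intro!: derivative_eq_intros u_deriv simp: algebra_simps power2_eq_square)
    moreover have "2 * h z * exp (2 * z) \<le> 0" 
      by (rule mult_nonpos_nonneg) (use h_nonpos[of z] z in auto)
    ultimately show "\<exists>d. ((\<lambda>x. (u e l t x)\<^sup>2 * exp (2 * x)) has_real_derivative d) (at z) \<and> d \<le> 0" by blast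
  qed
  define K where "K = max (\<bar>u e l t X\<bar> * exp X) \<bar>du e l t X\<bar>"
  have "\<bar>u e l t x\<bar> \<le> K * exp (- x) \<and> \<bar>du e l t x\<bar> \<le> K" if "x \<ge> X" for x
  proof
    have "(u e l t x * exp x)\<^sup>2 \<le> (u e l t X * exp X)\<^sup>2"
      using ue[OF that] by (simp add: power_mult_distrib exp_double)
    then have "\<bar>u e l t x * exp x\<bar> \<le> \<bar>u e l t X * exp X\<bar>" by (simp add: abs_le_square_iff)
    then have "\<bar>u e l t x\<bar> * exp x \<le> K" by (simp add: K_def abs_mult)
    then show "\<bar>u e l t x\<bar> \<le> K * exp (- x)" by (simp add: exp_minus field_simps)
    have "\<bar>du e l t x\<bar> \<le> \<bar>du e l t X\<bar>" using du2_anti[of X x] that by (simp add: abs_le_square_iff)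
    then show "\<bar>du e l t x\<bar> \<le> K" by (simp add: K_def)
  qed
  then show ?thesis
    by (intro exI[of _ K] eventually_mono[OF eventually_ge_at_top[of X]]) auto
qed

lemma decaying_wronskian_tendsto_0:
  assumes "decaying e l t j" "decaying e' l' t j'"
  shows "((\<lambda>x. u e l t x * du e' l' t x - du e l t x * u e' l' t x) \<longlongrightarrow> 0) at_top"
proof -
  obtain K where K: "\<forall>\<^sub>F x in at_top. \<bar>u e l t x\<bar> \<le> K * exp (- x) \<and> \<bar>du e l t x\<bar> \<le> K"
    using decaying_decay[OF assms(1)] by blast
  obtain K' where K': "\<forall>\<^sub>F x in at_top. \<bar>u e' l' t x\<bar> \<le> K' * exp (- x) \<and> \<bar>du e' l' t x\<bar> \<le> K'"
    using decaying_decay[OF assms(2)] by blast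
  have "((\<lambda>x::real. exp (- x)) \<longlongrightarrow> 0) at_top"
    by (rule filterlim_compose[OF exp_at_bot filterlim_uminus_at_bot_at_top])
  then show ?thesis
  proof (rule tendsto_0_le[where K = "2 * K * K'"])
    show "\<forall>\<^sub>F x in at_top. norm (u e l t x * du e' l' t x - du e l t x * u e' l' t x) \<le> norm (exp (- x)) * (2 * K * K')"
      using K K'
    proof eventually_elim
      case (elim x)
      have "\<bar>u e l t x * du e' l' t x\<bar> \<le> (K * exp (- x)) * K'"
        unfolding abs_mult using elim by (intro mult_mono) (auto intro: order_trans[OF abs_ge_zero])
      moreover have "\<bar>du e l t x * u e' l' t x\<bar> \<le> K * (K' * exp (- x))"
        unfolding abs_mult using elim by (intro mult_mono) (auto intro: order_trans[OF abs_ge_zero])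
      moreover have "norm (exp (- x)) * (2 * K * K') = (K * exp (- x)) * K' + K * (K' * exp (- x))"
        by simp
      ultimately show ?case unfolding real_norm_def[of "_ - _"] by linarith
    qed
  qed
qed

lemma not_decaying_both: "decaying True l t j \<Longrightarrow> decaying False l t j' \<Longrightarrow> False"
  using decaying_wronskian_tendsto_0[of True l t j False l j']
  unfolding wronskian by (simp add: tendsto_const_iff)

lemma wronskian_deriv:
  "((\<lambda>x. u e l t x * du e' l' t x - du e l t x * u e' l' t x) has_real_derivative (l - l') * (u e l t x * u e' l' t x)) (at x)"
  by (auto intro!: derivative_eq_intros u_deriv du_deriv simp: algebra_simps)

text \<open>A smaller \<open>l\<close> with the same decay forces every \<open>m\<close> between it
  and the threshold to decay at the same level, since its angle is squeezed. The Wronskian of the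
  solutions for \<open>l\<close> and \<open>m\<close> is then nonpositive by the order of the angles
  and strictly decreasing by their common sign, so it cannot tend to \<open>0\<close>.\<close>

lemma decaying_unique:
  assumes "decaying e l t (Suc k)"
  shows "l = parity_eigval e k t"
proof (rule ccontr)
  assume "l \<noteq> parity_eigval e k t"
  moreover have "l \<notin> reach e k t"
    using decaying_less[OF assms] by (meson reach_E not_le)
  then have "l \<le> parity_eigval e k t" using parity_eigval_less[of e k t l] by force
  ultimately have "l < parity_eigval e k t" by simp
  then obtain m where m: "l < m" "m < parity_eigval e k t" using dense by blast
  then have "m \<notin> reach e k t" using parity_eigval_le[of m e k t] by auto
  then have lt: "angle e m t x < real (Suc k) * pi" if "x \<ge> 0" for x
    using that by (intro not_reach_D)
  have bm: "decaying e m t (Suc k)"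
    using assms[unfolded decaying_def] eventually_ge_at_top[of 0] unfolding decaying_def
  proof eventually_elim
    case (elim x)
    then show ?case using lt[of x] angle_mono[of l m x e t] m(1) by auto
  qed
  define w where "w = (\<lambda>x. u e l t x * du e m t x - du e l t x * u e m t x)"
  have w0: "(w \<longlongrightarrow> 0) at_top" unfolding w_def by (rule decaying_wronskian_tendsto_0[OF assms bm])
  have dw: "(w has_real_derivative (l - m) * (u e l t x * u e m t x)) (at x)" for x
    unfolding w_def by (rule wronskian_deriv)
  obtain X where X: "X \<ge> 0"
    "\<And>x. x \<ge> X \<Longrightarrow> real (Suc k) * pi - pi / 2 < angle e l t x \<and> angle e l t x < real (Suc k) * pi"
    "\<And>x. x \<ge> X \<Longrightarrow> real (Suc k) * pi - pi / 2 < angle e m t x \<and> angle e m t x < real (Suc k) * pi"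
  proof -
    obtain X1 X2 where "\<And>x. x \<ge> X1 \<Longrightarrow> real (Suc k) * pi - pi / 2 < angle e l t x \<and> angle e l t x < real (Suc k) * pi"
      "\<And>x. x \<ge> X2 \<Longrightarrow> real (Suc k) * pi - pi / 2 < angle e m t x \<and> angle e m t x < real (Suc k) * pi"
      using assms bm unfolding decaying_def eventually_at_top_linorder by metis
    then show thesis using that[of "max 0 (max X1 X2)"] by auto
  qed
  have w_nonpos: "w x \<le> 0" if "x \<ge> X" for x
  proof -
    have "w x = rho e l t x * rho e m t x * sin (angle e l t x - angle e m t x)"
      using X(1) that by (simp add: w_def sin_diff u_polar du_polar algebra_simps)
    moreover have "sin (angle e m t x - angle e l t x) \<ge> 0"
      using X(2,3)[OF that] angle_mono[of l m x e t] m(1) X(1) that by (intro sin_ge_zero) auto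
    then have "sin (angle e l t x - angle e m t x) \<le> 0"
      using sin_minus[of "angle e m t x - angle e l t x"] by simp
    ultimately show ?thesis
      using rho_pos[of e l t x] rho_pos[of e m t x] by (simp add: mult_nonneg_nonpos less_imp_le)
  qed
  \<comment> \<open>Both angles lie in the same quarter turn below \<open>(k + 1) * pi\<close>, so
    the solutions have the same sign.\<close>
  have pos: "u e l t x * u e m t x > 0" if "x \<ge> X" for x
  proof -
    have s: "sin (real (Suc k) * pi - y) > 0 " if "real (Suc k) * pi - pi / 2 < y" "y < real (Suc k) * pi" for y
      using that by (intro sin_gt_zero) auto
    have "sin (real (Suc k) * pi - angle e l t x) * sin (real (Suc k) * pi - angle e m t x) > 0"
      using X(2,3)[OF that] by (intro mult_pos_pos s) auto
    also have "sin (real (Suc k) * pi - angle e l t x) * sin (real (Suc k) * pi - angle e m t x)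
       = ((- 1) ^ Suc k)\<^sup>2 * (sin (angle e l t x) * sin (angle e m t x))"
      unfolding sin_diff sin_npi cos_npi by (simp add: power2_eq_square)
    also have "((- 1::real) ^ Suc k)\<^sup>2 = 1" by (simp add: power_mult[symmetric])
    finally have "sin (angle e l t x) * sin (angle e m t x) > 0" by simp
    moreover have "u e l t x * u e m t x = (rho e l t x * rho e m t x) * (sin (angle e l t x) * sin (angle e m t x))"
      using X(1) that by (simp add: u_polar)
    ultimately show ?thesis using rho_pos[of e l t x] rho_pos[of e m t x] by simp
  qed
  have w_less: "w y < w x" if "X \<le> x" "x < y" for x y
    using that(2)
  proof (rule DERIV_neg_imp_decreasing)
    fix z assume "x \<le> z" "z \<le> y"
    then have "(l - m) * (u e l t z * u e m t z) < 0"
      using pos[of z] that m(1) by (intro mult_neg_pos) auto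
    then show "\<exists>d. (w has_real_derivative d) (at z) \<and> d < 0" using dw by blast
  qed
  have "w (X + 1) < 0" using w_less[of X "X + 1"] w_nonpos[of X] by simp
  moreover have "0 \<le> w (X + 1)"
  proof (rule tendsto_upperbound[OF w0])
    show "\<forall>\<^sub>F x in at_top. w x \<le> w (X + 1)"
      using eventually_gt_at_top[of "X + 1"] by eventually_elim (use w_less in \<open>auto intro: less_imp_le\<close>)
  qed simp
  ultimately show False by simp
qed

text \<open>The upper estimate is openness of \<open>reach\<close>. For the lower estimate,
  uniqueness shows that a value below the threshold does not decay at this level, so that its
  staying outside \<open>reach\<close> is stable in \<open>t\<close>.\<close>

lemma continuous_on_parity_eigval: "continuous_on UNIV (parity_eigval e k)"
proof -
  have "(parity_eigval e k \<longlongrightarrow> parity_eigval e k t) (nhds t)" for t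
  proof (rule order_tendstoI)
    fix a assume "a < parity_eigval e k t"
    then obtain l where l: "a < l" "l < parity_eigval e k t" using dense by blast
    have "l \<notin> reach e k t" using parity_eigval_le[of l e k t] l(2) by auto
    moreover have "\<not> decaying e l t (Suc k)" using decaying_unique[of e l t k] l(2) by auto
    ultimately have "\<forall>\<^sub>F t' in nhds t. l \<notin> reach e k t'"
      using eventually_nhds_slice(2)[where l = l and t = t and P = "\<lambda>l t. l \<notin> reach e k t"] not_in_reach_near by simp
    then show "\<forall>\<^sub>F t' in nhds t. a < parity_eigval e k t'"
    proof eventually_elim
      case (elim t')
      then show ?case using parity_eigval_less[of e k t' l] l(1) by force
    qed
  next
    fix a assume "parity_eigval e k t < a"
    then obtain l where l: "parity_eigval e k t < l" "l < a" using dense by blast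
    then have "l \<in> reach e k t" by (intro parity_eigval_less)
    then have "\<forall>\<^sub>F t' in nhds t. l \<in> reach e k t'"
      using eventually_nhds_slice(2)[where l = l and t = t and P = "\<lambda>l t. l \<in> reach e k t"] reach_near by simp
    then show "\<forall>\<^sub>F t' in nhds t. parity_eigval e k t' < a"
    proof eventually_elim
      case (elim t')
      then show ?case using parity_eigval_le[of l e k t'] l(2) by force
    qed
  qed
  then show ?thesis
    unfolding continuous_on_def using tendsto_mono[OF at_within_le_nhds] by blast
qed

section \<open>Interlacing and enumeration of the eigenvalues\<close>

definition eigval :: "nat \<Rightarrow> real \<Rightarrow> real" where
  "eigval n t = parity_eigval (even n) (n div 2) t"

text \<open>Interlacing of the angles gives an inclusion of the \<open>reach\<close> sets and hence
  the weak inequality; equality would make both parities decay at the same value.\<close>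

lemma parity_eigval_False_gt: "parity_eigval True k t < parity_eigval False k t"
proof -
  have "reach False k t \<subseteq> reach True k t"
  proof
    fix l assume "l \<in> reach False k t"
    then obtain x where x: "x \<ge> 0" "real (Suc k) * pi \<le> angle False l t x" by (rule reach_E)
    then have "real (Suc k) * pi \<le> angle True l t x" using angle_interlace(1)[of x l t] by linarith
    then show "l \<in> reach True k t" using x(1) by (intro reach_I)
  qed
  then have "\<not> parity_eigval False k t < parity_eigval True k t"
    using parity_eigval_le[of _ True k t] parity_eigval_less[of False k t] by (meson dense not_le subsetD)
  moreover have "parity_eigval True k t \<noteq> parity_eigval False k t"
    using not_decaying_both decaying_parity_eigval[of True k t] decaying_parity_eigval[of False k t] by metis
  ultimately show ?thesis by simp
qed

lemma parity_eigval_False_lt: "parity_eigval False k t < parity_eigval True (Suc k) t"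
proof -
  have "reach True (Suc k) t \<subseteq> reach False k t"
  proof
    fix l assume "l \<in> reach True (Suc k) t"
    then obtain x where x: "x \<ge> 0" "real (Suc (Suc k)) * pi \<le> angle True l t x" by (rule reach_E)
    moreover have "real (Suc (Suc k)) * pi = real (Suc k) * pi + pi" by (simp add: algebra_simps)
    ultimately have "real (Suc k) * pi \<le> angle False l t x" using angle_interlace(2)[of x l t] by linarith
    then show "l \<in> reach False k t" using x(1) by (intro reach_I)
  qed
  then have "\<not> parity_eigval True (Suc k) t < parity_eigval False k t"
    using parity_eigval_le[of _ False k t] parity_eigval_less[of True "Suc k" t] by (meson dense not_le subsetD)
  moreover have "parity_eigval True (Suc k) t \<noteq> parity_eigval False k t"
    using not_decaying_both decaying_parity_eigval[of True "Suc k" t] decaying_parity_eigval[of False k t] by metis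
  ultimately show ?thesis by simp
qed

lemma eigval_less_Suc: "eigval n t < eigval (Suc n) t"
proof (cases "even n")
  case True
  then have "Suc n div 2 = n div 2" by presburger
  then show ?thesis using True parity_eigval_False_gt by (simp add: eigval_def)
next
  case False
  then have "Suc n div 2 = Suc (n div 2)" by presburger
  then show ?thesis using False parity_eigval_False_lt by (simp add: eigval_def)
qed

lemma strict_mono_eigval: "strict_mono (\<lambda>n. eigval n t)"
  using eigval_less_Suc by (simp add: strict_mono_Suc_iff)

lemma decaying_iff_eigval: "(\<exists>e j. decaying e l t j) \<longleftrightarrow> l \<in> range (\<lambda>n. eigval n t)"
proof
  assume "\<exists>e j. decaying e l t j"
  then obtain e j where b: "decaying e l t j" by blast
  then obtain k where "j = Suc k" using decaying_pos by blast
  then have "l = parity_eigval e k t" using decaying_unique b by simp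
  moreover have "parity_eigval e k t = eigval (if e then 2 * k else Suc (2 * k)) t" by (simp add: eigval_def)
  ultimately show "l \<in> range (\<lambda>n. eigval n t)" by blast
next
  assume "l \<in> range (\<lambda>n. eigval n t)"
  then show "\<exists>e j. decaying e l t j" unfolding eigval_def using decaying_parity_eigval by blast
qed

text \<open>At \<open>X\<close> the angle is some finite number, and beyond \<open>X\<close> a trap
  above it prevents it from ever reaching high levels.\<close>

lemma eigval_unbounded: "\<exists>n. L < eigval n t"
proof -
  obtain X where X: "X \<ge> 1" "\<And>l' t' x. \<bar>t'\<bar> \<le> \<bar>t\<bar> \<Longrightarrow> l' \<le> L \<Longrightarrow> x \<ge> X \<Longrightarrow> W t' x - l' \<ge> 2"
    using W_coercive[where T = "\<bar>t\<bar>" and L = L] by blast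
  obtain j :: nat where "angle True L t X / pi \<le> real j" using real_arch_simple by blast
  then have "angle True L t X \<le> real j * pi" by (simp add: pos_divide_le_eq)
  then have "angle True L t X \<le> real j * pi + pi / 2" using pi_gt_zero by linarith
  moreover have "W t z - L > 0" if "z \<ge> X" for z using X(2)[of t L z] that by simp
  ultimately have "L \<notin> reach True j t"
    using X(1) by (intro not_in_reach[of X]) auto
  then have "L \<le> parity_eigval True j t" using parity_eigval_less[of True j t L] by force
  then have "L < eigval (Suc (2 * j)) t" using eigval_less_Suc[of "2 * j" t] by (simp add: eigval_def)
  then show ?thesis by blast
qed

lemma continuous_on_eigval: "continuous_on A (eigval n)"
  unfolding eigval_def[abs_def] by (rule continuous_on_subset[OF continuous_on_parity_eigval]) auto

end

section \<open>Square integrability\<close>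

text \<open>The sum over \<open>x\<close> and \<open>- x\<close> is what a growing component of
  definite parity bounds from below; either half of the eigenfunction alone might be small.\<close>

lemma square_sum_bound_not_integrable:
  fixes f :: "real \<Rightarrow> real"
  assumes f: "f integrable_on UNIV" and nonneg: "\<And>x. f x \<ge> 0" and "c > 0"
    and ge: "\<And>x. x \<ge> a \<Longrightarrow> f x + f (- x) \<ge> c"
  shows False
proof -
  define b where "b = a + (2 * integral UNIV f + 1) / c"
  have I: "integral UNIV f \<ge> 0" using f nonneg by (intro integral_nonneg) auto
  then have b: "b \<ge> a" using \<open>c > 0\<close> by (simp add: b_def)
  have int: "f integrable_on {x..y}" for x y
    by (rule integrable_on_subinterval[OF f]) auto
  have le: "integral {x..y} f \<le> integral UNIV f" for x y
    using int f nonneg by (intro integral_subset_le) auto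
  have "f integrable_on {- b..- a}" by (rule int)
  then have int': "(\<lambda>x. f (- x)) integrable_on {a..b}"
    using Henstock_Kurzweil_Integration.integrable_reflect_real[where f = "\<lambda>x. f (- x)" and a = a and b = b] by simp
  have "c * (b - a) = integral {a..b} (\<lambda>x. c)" using b by simp
  also have "\<dots> \<le> integral {a..b} (\<lambda>x. f x + f (- x))"
    using ge int int' by (intro integral_le integrable_add) auto
  also have "\<dots> = integral {a..b} f + integral {a..b} (\<lambda>x. f (- x))"
    by (rule integral_add[OF int int'])
  also have "integral {a..b} (\<lambda>x. f (- x)) = integral {- b..- a} f"
    using Henstock_Kurzweil_Integration.integral_reflect_real[where f = "\<lambda>x. f (- x)" and a = a and b = b] by simp
  also have "integral {a..b} f + integral {- b..- a} f \<le> 2 * integral UNIV f"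
    using le[of a b] le[of "- b" "- a"] by linarith
  finally have "c * (b - a) \<le> 2 * integral UNIV f" .
  moreover have "c * (b - a) = 2 * integral UNIV f + 1" using \<open>c > 0\<close> by (simp add: b_def)
  ultimately show False by simp
qed

lemma integrable_even_exp_decay:
  fixes f :: "real \<Rightarrow> real"
  assumes cont: "continuous_on UNIV f" and even: "\<And>x. f (- x) = f x" and "c > 0"
    and le: "\<And>x. x \<ge> X \<Longrightarrow> \<bar>f x\<bar> \<le> K * exp (- c * x)"
  shows "f integrable_on UNIV"
proof -
  define Y where "Y = max X 0"
  \<comment> \<open>Needed both for \<open>f\<close> and for its norm, because the reflection to the
    negative half line is carried out for absolutely integrable functions.\<close>
  have half: "g integrable_on {0..}" if g: "continuous_on UNIV g" "\<And>x. \<bar>g x\<bar> = \<bar>f x\<bar>" for g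
  proof (rule integrable_Un')
    show "g integrable_on {0..Y}"
      by (intro integrable_continuous_real continuous_on_subset[OF g(1)]) auto
    show "g integrable_on {Y..}"
    proof (rule integrable_on_all_intervals_integrable_bound)
      show "(\<lambda>x. K * exp (- c * x)) integrable_on {Y..}"
        using integrable_on_cmult_left[OF integrable_on_exp_minus_to_infinity[OF \<open>c > 0\<close>], of K] by simp
      show "norm (g x) \<le> K * exp (- c * x)" if "x \<in> {Y..}" for x
        using le[of x] that g(2) by (simp add: Y_def)
      fix a b :: real
      have "{Y..} \<inter> cbox a b = {max Y a..b}" by auto
      then show "(\<lambda>x. if x \<in> {Y..} then g x else 0) integrable_on cbox a b"
        unfolding integrable_restrict_Int
        by (auto intro!: integrable_continuous_real continuous_on_subset[OF g(1)])
    qed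
    show "negligible ({0..Y} \<inter> {Y..})"
      by (rule negligible_subset[of "{Y}"]) auto
    show "{0..} = {0..Y} \<union> {Y..}" by (auto simp: Y_def)
  qed
  have "(\<lambda>x. f x) absolutely_integrable_on {0..}"
    unfolding absolutely_integrable_on_def
    using half[OF cont] half[of "\<lambda>x. norm (f x)"] cont by (auto intro!: continuous_intros)
  then have "(\<lambda>x. f (- x)) absolutely_integrable_on {..0}"
    using has_absolute_integral_reflect_real[of "{..0}" "{0..}" f] by auto
  then have "f integrable_on {..0}"
    unfolding even by (rule set_lebesgue_integral_eq_integral(1))
  moreover have "negligible ({..0::real} \<inter> {0..})"
    by (rule negligible_subset[of "{0}"]) auto
  moreover have "(UNIV::real set) = {..0} \<union> {0..}" by auto
  ultimately show ?thesis using half[OF cont] by (metis integrable_Un')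
qed

context anharmonic
begin

section \<open>Translation to the original eigenvalue problem\<close>

definition P :: "real \<Rightarrow> real" where "P x = (\<Sum>k = 1..r. v k * x ^ (2 * k))"

lemma W_scale:
  assumes "t \<ge> 0"
  shows "W t (sqrt t * x) = 2 * t ^ r * P x"
proof -
  have "2 * v k * t ^ (r - k) * (sqrt t * x) ^ (2 * k) = 2 * t ^ r * (v k * x ^ (2 * k))" if "k \<in> {1..r}" for k
  proof -
    have "(sqrt t * x) ^ (2 * k) = t ^ k * x ^ (2 * k)"
      using assms by (simp add: power_mult_distrib power_mult)
    moreover have "t ^ (r - k) * t ^ k = t ^ r" using that by (simp add: power_add[symmetric])
    ultimately show ?thesis by (metis (no_types, lifting) mult.assoc mult.left_commute)
  qed
  then show ?thesis unfolding W_def P_def sum_distrib_left by (intro sum.cong) auto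
qed

lemma scaled_u_deriv:
  assumes "t \<ge> 0"
  shows "((\<lambda>x. u e l t (sqrt t * x)) has_real_derivative sqrt t * du e l t (sqrt t * x)) (at x)"
    and "((\<lambda>x. sqrt t * du e l t (sqrt t * x)) has_real_derivative
           t * (2 * t ^ r * P x - l) * u e l t (sqrt t * x)) (at x)"
proof -
  have 1: "((\<lambda>x. sqrt t * x) has_real_derivative sqrt t) (at x)"
    by (auto intro!: derivative_eq_intros)
  show "((\<lambda>x. u e l t (sqrt t * x)) has_real_derivative sqrt t * du e l t (sqrt t * x)) (at x)"
    using DERIV_chain2[OF u_deriv[of e l t "sqrt t * x"] 1] by (simp add: mult.commute)
  have "((\<lambda>x. du e l t (sqrt t * x)) has_real_derivative (2 * t ^ r * P x - l) * u e l t (sqrt t * x) * sqrt t) (at x)"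
    using DERIV_chain2[OF du_deriv[of e l t "sqrt t * x"] 1] unfolding W_scale[OF assms] .
  then have "((\<lambda>x. sqrt t * du e l t (sqrt t * x)) has_real_derivative
      sqrt t * ((2 * t ^ r * P x - l) * u e l t (sqrt t * x) * sqrt t)) (at x)"
    by (rule DERIV_cmult)
  moreover have "sqrt t * ((2 * t ^ r * P x - l) * u e l t (sqrt t * x) * sqrt t)
      = (sqrt t * sqrt t) * (2 * t ^ r * P x - l) * u e l t (sqrt t * x)" by algebra
  moreover have "sqrt t * sqrt t = t" using assms by simp
  ultimately show "((\<lambda>x. sqrt t * du e l t (sqrt t * x)) has_real_derivative
           t * (2 * t ^ r * P x - l) * u e l t (sqrt t * x)) (at x)" by simp
qed

text \<open>An eigenfunction is complex valued and need not have a parity. Its Wronskians with the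
  odd and even solutions are constants \<open>A\<close> and \<open>B\<close>, which are its
  coordinates in this basis up to sign and a factor \<open>sqrt t\<close>. A nonzero coordinate
  excludes growth of the corresponding solution. Conversely, a decaying solution is itself an
  eigenfunction after scaling.\<close>

lemma is_eigenvalue_iff:
  assumes t: "t > 0" and pot: "\<And>x. pot a b r x = P x"
  shows "is_eigenvalue (t ^ (r + 1)) a b r E \<longleftrightarrow> (\<exists>e j. decaying e (2 * t ^ r * E) t j)"
proof
  define l where "l = 2 * t ^ r * E"
  define m where "m = t ^ (r + 1)"
  have m: "m > 0" using t by (simp add: m_def)
  have s: "sqrt t > 0" using t by simp
  have coef: "t * (2 * t ^ r * P x - l) = 2 * m * (P x - E)" for x
    by (simp add: l_def m_def algebra_simps)
  let ?u = "\<lambda>e x. u e l t (sqrt t * x)"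
  let ?d = "\<lambda>e x. sqrt t * du e l t (sqrt t * x)"
  have du: "(?u e has_real_derivative ?d e x) (at x)" for e x
    using t by (intro scaled_u_deriv) auto
  have dd: "(?d e has_real_derivative 2 * m * (P x - E) * ?u e x) (at x)" for e x
    using scaled_u_deriv(2)[of t e l x] t unfolding coef by simp
  {
    assume "is_eigenvalue (t ^ (r + 1)) a b r E"
    then obtain \<psi> \<psi>1 \<psi>2 :: "real \<Rightarrow> complex" and x0 where \<psi>: "\<psi> x0 \<noteq> 0"
        "(\<lambda>x. (cmod (\<psi> x))\<^sup>2) integrable_on UNIV"
        "\<And>x. (\<psi> has_vector_derivative \<psi>1 x) (at x)" "\<And>x. (\<psi>1 has_vector_derivative \<psi>2 x) (at x)"
        "\<And>x. - (1 / (2 * m)) *\<^sub>R \<psi>2 x + P x *\<^sub>R \<psi> x = E *\<^sub>R \<psi> x"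
      unfolding is_eigenvalue_def pot m_def by blast
    have \<psi>2: "\<psi>2 x = (2 * m * (P x - E)) *\<^sub>R \<psi> x" for x
    proof -
      have "(1 / (2 * m)) *\<^sub>R \<psi>2 x = (P x - E) *\<^sub>R \<psi> x"
        using \<psi>(5)[of x] by (simp add: scaleR_diff_left algebra_simps)
      then have "(2 * m) *\<^sub>R ((1 / (2 * m)) *\<^sub>R \<psi>2 x) = (2 * m) *\<^sub>R ((P x - E) *\<^sub>R \<psi> x)" by simp
      then show ?thesis using m by simp
    qed
    have const: "\<exists>c. \<forall>x. ?d e x *\<^sub>R \<psi> x - ?u e x *\<^sub>R \<psi>1 x = c" for e
    proof -
      have "((\<lambda>x. ?d e x *\<^sub>R \<psi> x - ?u e x *\<^sub>R \<psi>1 x) has_vector_derivative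
          (?d e x *\<^sub>R \<psi>1 x + (2 * m * (P x - E) * ?u e x) *\<^sub>R \<psi> x) - (?u e x *\<^sub>R \<psi>2 x + ?d e x *\<^sub>R \<psi>1 x)) (at x)" for x
        by (intro has_vector_derivative_diff has_vector_derivative_scaleR dd du \<psi>)
      then have *: "((\<lambda>x. ?d e x *\<^sub>R \<psi> x - ?u e x *\<^sub>R \<psi>1 x) has_vector_derivative 0) (at x within UNIV)" for x
        unfolding \<psi>2 by (simp add: mult_ac)
      show ?thesis
        by (rule has_vector_derivative_zero_constant[OF convex_UNIV *]) blast
    qed
    obtain A B where A: "\<And>x. ?d False x *\<^sub>R \<psi> x - ?u False x *\<^sub>R \<psi>1 x = A"
      and B: "\<And>x. ?d True x *\<^sub>R \<psi> x - ?u True x *\<^sub>R \<psi>1 x = B"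
      using const[of True] const[of False] by blast
    have rep: "sqrt t *\<^sub>R \<psi> x = ?u True x *\<^sub>R A - ?u False x *\<^sub>R B" for x
    proof -
      have "?u True x *\<^sub>R A - ?u False x *\<^sub>R B = (?u True x * ?d False x - ?d True x * ?u False x) *\<^sub>R \<psi> x"
        unfolding A[of x, symmetric] B[of x, symmetric] by (simp add: scaleR_diff_right scaleR_diff_left mult_ac)
      also have "?u True x * ?d False x - ?d True x * ?u False x
          = sqrt t * (?u True x * du False l t (sqrt t * x) - du True l t (sqrt t * x) * ?u False x)"
        by (simp add: algebra_simps)
      also have "\<dots> = sqrt t" unfolding wronskian by simp
      finally show ?thesis by simp
    qed
    \<comment> \<open>A growing component of \<open>\<psi>\<close> can be isolated by parity, and it is not square integrable.\<close>
    have decaying: "\<exists>j. decaying e l t j"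
      if "C \<noteq> 0" and par: "\<And>x. sqrt t *\<^sub>R (\<psi> x + \<sigma> * \<psi> (- x)) = (2 * ?u e x) *\<^sub>R C" and \<sigma>: "cmod \<sigma> = 1"
      for e C \<sigma>
    proof (rule ccontr)
      assume "\<not> ?thesis"
      then obtain j where "growing e l t j" using decaying_or_growing by blast
      then obtain X where X: "\<And>x. x \<ge> X \<Longrightarrow> u e l t x * du e l t x > 0"
        using growing_increasing unfolding eventually_at_top_linorder by blast
      define \<eta> where "\<eta> = (u e l t X)\<^sup>2"
      have "\<eta> > 0" using X[of X] by (auto simp: \<eta>_def)
      have mono: "\<eta> \<le> (u e l t y)\<^sup>2" if "y \<ge> X" for y
        unfolding \<eta>_def
      proof (rule DERIV_nonneg_imp_nondecreasing[OF that])
        fix z assume z: "X \<le> z" "z \<le> y"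
        have "((\<lambda>x. (u e l t x)\<^sup>2) has_real_derivative 2 * (u e l t z * du e l t z)) (at z)"
          by (auto intro!: derivative_eq_intros u_deriv)
        then show "\<exists>d. ((\<lambda>x. (u e l t x)\<^sup>2) has_real_derivative d) (at z) \<and> 0 \<le> d"
          using X[of z] z by (intro exI[of _ "2 * (u e l t z * du e l t z)"] conjI) linarith+
      qed
      show False
      proof (rule square_sum_bound_not_integrable[OF \<psi>(2)])
        show "2 * \<eta> * (cmod C)\<^sup>2 / t > 0" using \<open>\<eta> > 0\<close> \<open>C \<noteq> 0\<close> t by simp
        fix x assume x: "x \<ge> X / sqrt t"
        have "(cmod (sqrt t *\<^sub>R (\<psi> x + \<sigma> * \<psi> (- x))))\<^sup>2 = 4 * (?u e x)\<^sup>2 * (cmod C)\<^sup>2"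
          unfolding par by (simp add: power_mult_distrib)
        moreover have "(cmod (sqrt t *\<^sub>R (\<psi> x + \<sigma> * \<psi> (- x))))\<^sup>2 = t * (cmod (\<psi> x + \<sigma> * \<psi> (- x)))\<^sup>2"
          using t by (simp add: power_mult_distrib)
        ultimately have eq: "t * (cmod (\<psi> x + \<sigma> * \<psi> (- x)))\<^sup>2 = 4 * (?u e x)\<^sup>2 * (cmod C)\<^sup>2" by simp
        have "(cmod (\<psi> x + \<sigma> * \<psi> (- x)))\<^sup>2 \<le> (cmod (\<psi> x) + cmod (\<psi> (- x)))\<^sup>2"
          using norm_triangle_ineq[of "\<psi> x" "\<sigma> * \<psi> (- x)"] \<sigma> by (intro power_mono) (auto simp: norm_mult)
        also have "\<dots> \<le> 2 * ((cmod (\<psi> x))\<^sup>2 + (cmod (\<psi> (- x)))\<^sup>2)"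
          using zero_le_power2[of "cmod (\<psi> x) - cmod (\<psi> (- x))"] by (simp add: power2_eq_square algebra_simps)
        finally have *: "(cmod (\<psi> x + \<sigma> * \<psi> (- x)))\<^sup>2 \<le> 2 * ((cmod (\<psi> x))\<^sup>2 + (cmod (\<psi> (- x)))\<^sup>2)" .
        have "sqrt t * x \<ge> X" using x s by (simp add: pos_divide_le_eq mult.commute)
        then have "\<eta> * (cmod C)\<^sup>2 \<le> (?u e x)\<^sup>2 * (cmod C)\<^sup>2" by (intro mult_right_mono mono) auto
        then have "4 * (\<eta> * (cmod C)\<^sup>2) \<le> t * (cmod (\<psi> x + \<sigma> * \<psi> (- x)))\<^sup>2" unfolding eq by simp
        also have "\<dots> \<le> t * (2 * ((cmod (\<psi> x))\<^sup>2 + (cmod (\<psi> (- x)))\<^sup>2))"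
          using * t by (intro mult_left_mono) auto
        finally have "2 * \<eta> * (cmod C)\<^sup>2 \<le> ((cmod (\<psi> x))\<^sup>2 + (cmod (\<psi> (- x)))\<^sup>2) * t" by (simp add: algebra_simps)
        then show "2 * \<eta> * (cmod C)\<^sup>2 / t \<le> (cmod (\<psi> x))\<^sup>2 + (cmod (\<psi> (- x)))\<^sup>2"
          using t by (simp add: pos_divide_le_eq)
      qed auto
    qed
    have "A \<noteq> 0 \<or> B \<noteq> 0"
      using rep[of x0] \<psi>(1) s by auto
    then have "\<exists>e j. decaying e l t j"
    proof
      assume "A \<noteq> 0"
      moreover have "sqrt t *\<^sub>R (\<psi> x + 1 * \<psi> (- x)) = (2 * ?u True x) *\<^sub>R A" for x
        using rep[of x] rep[of "- x"] by (simp add: u_minus scaleR_add_right) (simp add: scaleR_conv_of_real mult_ac)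
      ultimately show ?thesis using decaying[of A 1 True] by auto
    next
      assume "B \<noteq> 0"
      moreover have "sqrt t *\<^sub>R (\<psi> x + (- 1) * \<psi> (- x)) = (2 * ?u False x) *\<^sub>R (- B)" for x
        using rep[of x] rep[of "- x"] by (simp add: u_minus scaleR_diff_right) (simp add: scaleR_conv_of_real mult_ac)
      ultimately show ?thesis using decaying[of "- B" "- 1" False] by auto
    qed
    then show "\<exists>e j. decaying e (2 * t ^ r * E) t j" by (simp add: l_def)
  next
    assume "\<exists>e j. decaying e (2 * t ^ r * E) t j"
    then obtain e j where "decaying e l t j" by (auto simp: l_def)
    then obtain K where "\<forall>\<^sub>F x in at_top. \<bar>u e l t x\<bar> \<le> K * exp (- x) \<and> \<bar>du e l t x\<bar> \<le> K"
      using decaying_decay by blast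
    then obtain X where X: "\<And>x. x \<ge> X \<Longrightarrow> \<bar>u e l t x\<bar> \<le> K * exp (- x)"
      unfolding eventually_at_top_linorder by blast
    have "(\<lambda>x. (?u e x)\<^sup>2) integrable_on UNIV"
    proof (rule integrable_even_exp_decay)
      show "continuous_on UNIV (\<lambda>x. (?u e x)\<^sup>2)"
        by (intro continuous_intros continuous_on_compose2[OF continuous_on_u_x(1)[of UNIV]]) auto
      show "(?u e (- x))\<^sup>2 = (?u e x)\<^sup>2" for x by (simp add: u_minus)
      show "2 * sqrt t > 0" using s by simp
      fix x assume x: "x \<ge> X / sqrt t"
      then have "\<bar>?u e x\<bar> \<le> K * exp (- (sqrt t * x))"
        using s by (intro X) (simp add: pos_divide_le_eq mult.commute)
      then have "\<bar>?u e x\<bar>\<^sup>2 \<le> (K * exp (- (sqrt t * x)))\<^sup>2" by (intro power_mono) auto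
      also have "\<dots> = K\<^sup>2 * exp (- (2 * sqrt t) * x)"
        by (simp add: power_mult_distrib exp_double[symmetric])
      finally show "\<bar>(?u e x)\<^sup>2\<bar> \<le> K\<^sup>2 * exp (- (2 * sqrt t) * x)" by simp
    qed
    moreover have "\<exists>x. complex_of_real (?u e x) \<noteq> 0"
    proof (rule ccontr)
      assume "\<not> ?thesis"
      then have "?u e = (\<lambda>x. 0)" by auto
      then have "?d e 0 = 0" using du[of e 0] DERIV_unique DERIV_const by metis
      then show False using \<open>?u e = (\<lambda>x. 0)\<close> u_nontrivial[of e l t 0] s by (auto dest: fun_cong[of _ _ 0])
    qed
    moreover have "- (1 / (2 * m)) *\<^sub>R complex_of_real (2 * m * (P x - E) * ?u e x) + P x *\<^sub>R complex_of_real (?u e x)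
        = E *\<^sub>R complex_of_real (?u e x)" for x
    proof -
      have "- (1 / (2 * m)) * (2 * m * (P x - E) * ?u e x) + P x * ?u e x = E * ?u e x"
        using m by (simp add: algebra_simps)
      then show ?thesis unfolding scaleR_conv_of_real of_real_mult[symmetric] of_real_add[symmetric] by simp
    qed
    ultimately show "is_eigenvalue (t ^ (r + 1)) a b r E"
      unfolding is_eigenvalue_def pot m_def[symmetric]
      by (intro exI[of _ "\<lambda>x. complex_of_real (?u e x)"] exI[of _ "\<lambda>x. complex_of_real (?d e x)"]
            exI[of _ "\<lambda>x. complex_of_real (2 * m * (P x - E) * ?u e x)"] conjI allI
            has_vector_derivative_of_real du dd) auto
  }
qed

end

section \<open>Growth of the spectral gaps\<close>

context anharmonic
begin

definition dW :: "real \<Rightarrow> real \<Rightarrow> real" where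
  "dW t x = (\<Sum>k = 1..r. 2 * v k * t ^ (r - k) * (real (2 * k) * x ^ (2 * k - 1)))"

lemma W_deriv: "(W t has_real_derivative dW t x) (at x)"
  unfolding W_def[abs_def] dW_def
  by (rule DERIV_sum, rule DERIV_cmult) (auto intro!: derivative_eq_intros)

lemma x_dW: "x * dW t x = (\<Sum>k = 1..r. (2 * real (2 * k) * v k) * t ^ (r - k) * x ^ (2 * k))"
proof -
  have "x * (2 * v k * t ^ (r - k) * (real (2 * k) * x ^ (2 * k - 1))) = (2 * real (2 * k) * v k) * t ^ (r - k) * x ^ (2 * k)"
    if "k \<in> {1..r}" for k
  proof -
    have "x ^ (2 * k) = x * x ^ (2 * k - 1)" using that by (cases k) auto
    then show ?thesis by (simp add: mult_ac)
  qed
  then show ?thesis unfolding dW_def sum_distrib_left by (intro sum.cong) auto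
qed

text \<open>This is the derivative of \<open>(W t x - l) / (1 + d * x)\<close>, that is, the rate at
  which the energy loses multiples of \<open>u^2\<close>. For \<open>d = 0\<close> only
  \<open>dW t x\<close> would remain, which is \<open>0\<close> at the origin.\<close>

definition damp :: "real \<Rightarrow> real \<Rightarrow> real \<Rightarrow> real \<Rightarrow> real" where
  "damp d l t x = (dW t x + d * (x * dW t x - W t x) + d * l) / (1 + d * x)\<^sup>2"

definition energy :: "real \<Rightarrow> bool \<Rightarrow> real \<Rightarrow> real \<Rightarrow> real \<Rightarrow> real" where
  "energy d e l t x = ((du e l t x)\<^sup>2 - (W t x - l) * (u e l t x)\<^sup>2) / (1 + d * x)"

lemma energy_deriv:
  assumes "1 + d * x > 0"
  shows "(energy d e l t has_real_derivative - d * (du e l t x)\<^sup>2 / (1 + d * x)\<^sup>2 - damp d l t x * (u e l t x)\<^sup>2) (at x)"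
proof -
  let ?U = "u e l t x" and ?D = "du e l t x" and ?Q = "W t x - l" and ?g = "1 + d * x"
  have N: "((\<lambda>x. (du e l t x)\<^sup>2 - (W t x - l) * (u e l t x)\<^sup>2) has_real_derivative - (dW t x * ?U\<^sup>2)) (at x)"
    by (auto intro!: derivative_eq_intros u_deriv du_deriv W_deriv simp: algebra_simps power2_eq_square)
  have G: "((\<lambda>x. 1 + d * x) has_real_derivative d) (at x)" by (auto intro!: derivative_eq_intros)
  have "(energy d e l t has_real_derivative
      (- (dW t x * ?U\<^sup>2) * ?g - (?D\<^sup>2 - ?Q * ?U\<^sup>2) * d) / (?g * ?g)) (at x)"
    unfolding energy_def[abs_def] using assms by (intro DERIV_divide N G) auto
  moreover have "- (dW t x * ?U\<^sup>2) * ?g - (?D\<^sup>2 - ?Q * ?U\<^sup>2) * d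
      = - d * ?D\<^sup>2 - (dW t x + d * (x * dW t x - W t x) + d * l) * ?U\<^sup>2"
    by (simp add: algebra_simps)
  ultimately have "(energy d e l t has_real_derivative
      (- d * ?D\<^sup>2 - (dW t x + d * (x * dW t x - W t x) + d * l) * ?U\<^sup>2) / (?g * ?g)) (at x)"
    by (simp only:)
  then show ?thesis
    by (rule DERIV_cong) (simp add: damp_def power2_eq_square diff_divide_distrib)
qed

text \<open>By the arithmetic-geometric mean inequality \<open>c * x ^ (2 * r) + l\<close> is at
  least \<open>2 * sqrt (c * l) * x ^ r\<close>, and \<open>x ^ r \<ge> x ^ 2\<close> compensates
  the squared weight. This is where \<open>r \<ge> 2\<close> matters: for \<open>r = 1\<close> the
  eigenvalues are equally spaced.\<close>

lemma damp_lower_far: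
  assumes "d > 0" "x > 0" "d * x \<ge> 1" "l > 0" "c > 0"
    and "dW t x \<ge> 0" "x * dW t x - W t x \<ge> c * x ^ (2 * r)" "x \<ge> 1"
  shows "damp d l t x \<ge> sqrt (c * l) / (2 * d)"
proof -
  have "(sqrt c * x ^ r)\<^sup>2 + (sqrt l)\<^sup>2 \<ge> 2 * (sqrt c * x ^ r) * sqrt l"
    by (rule sum_squares_bound)
  moreover have "(x ^ r)\<^sup>2 = x ^ (2 * r)" by (simp add: power_mult[symmetric] mult.commute)
  ultimately have "c * x ^ (2 * r) + l \<ge> 2 * sqrt (c * l) * x ^ r"
    using assms by (simp add: power_mult_distrib real_sqrt_mult mult_ac)
  moreover have "x\<^sup>2 \<le> x ^ r" using r2 assms by (intro power_increasing) auto
  then have "2 * sqrt (c * l) * x\<^sup>2 \<le> 2 * sqrt (c * l) * x ^ r"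
    using assms by (intro mult_left_mono) auto
  ultimately have "2 * sqrt (c * l) * x\<^sup>2 \<le> x * dW t x - W t x + l" using assms by linarith
  then have "d * (2 * sqrt (c * l) * x\<^sup>2) \<le> d * (x * dW t x - W t x + l)"
    using assms by (intro mult_left_mono) auto
  then have N: "d * (2 * sqrt (c * l) * x\<^sup>2) \<le> dW t x + d * (x * dW t x - W t x) + d * l"
    using assms by (simp add: algebra_simps)
  have "sqrt (c * l) / (2 * d) = d * (2 * sqrt (c * l) * x\<^sup>2) / (2 * (d * x))\<^sup>2"
    using assms by (simp add: power2_eq_square)
  also have "\<dots> \<le> d * (2 * sqrt (c * l) * x\<^sup>2) / (1 + d * x)\<^sup>2"
  proof (intro divide_left_mono power_mono)
    show "0 < (2 * (d * x))\<^sup>2 * (1 + d * x)\<^sup>2"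
      using assms by (intro mult_pos_pos zero_less_power add_pos_pos) auto
  qed (use assms in auto)
  also have "\<dots> \<le> damp d l t x" unfolding damp_def by (intro divide_right_mono N) auto
  finally show ?thesis .
qed

lemma damp_lower:
  fixes T M :: real
  assumes "M > 0"
  shows "\<exists>d>0. \<exists>L>0. \<forall>t l x. \<bar>t\<bar> \<le> T \<longrightarrow> l \<ge> L \<longrightarrow> x \<ge> 0 \<longrightarrow> damp d l t x \<ge> M * sqrt l"
proof -
  define c where "c = (2 * real r - 1) * v r"
  have c: "c > 0" using vr r2 by (simp add: c_def)
  obtain A1 where A1: "A1 \<ge> 1" "\<And>t x. \<bar>t\<bar> \<le> T \<Longrightarrow> x \<ge> A1 \<Longrightarrow>
      (\<Sum>k = 1..r. (2 * real (2 * k) * v k) * t ^ (r - k) * x ^ (2 * k)) \<ge> (2 * real (2 * r) * v r) / 2 * x ^ (2 * r)"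
    using leading_term_dominates[of r "\<lambda>k. 2 * real (2 * k) * v k" T] vr r2 by auto
  obtain A2 where A2: "A2 \<ge> 1" "\<And>t x. \<bar>t\<bar> \<le> T \<Longrightarrow> x \<ge> A2 \<Longrightarrow>
      (\<Sum>k = 1..r. (2 * (2 * real k - 1) * v k) * t ^ (r - k) * x ^ (2 * k)) \<ge> (2 * (2 * real r - 1) * v r) / 2 * x ^ (2 * r)"
    using leading_term_dominates[of r "\<lambda>k. 2 * (2 * real k - 1) * v k" T] vr r2 by auto
  \<comment> \<open>This makes the far bound \<open>sqrt (c * l) / (2 * d)\<close> equal to
    \<open>M * sqrt l\<close>.\<close>
  define d where "d = sqrt c / (2 * M)"
  have d: "d > 0" using c assms by (simp add: d_def)
  define A where "A = max (max A1 A2) (1 / d)"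
  have A: "A \<ge> 1" "A \<ge> A1" "A \<ge> A2" "A \<ge> 1 / d" using A1(1) by (auto simp: A_def)
  have "compact ((\<lambda>(t, x). dW t x + d * (x * dW t x - W t x)) ` ({- T..T} \<times> {0..A}))"
    unfolding case_prod_unfold dW_def
    by (intro compact_continuous_image continuous_intros continuous_on_W compact_Times) auto
  then have "bdd_below ((\<lambda>(t, x). dW t x + d * (x * dW t x - W t x)) ` ({- T..T} \<times> {0..A}))"
    by (intro bounded_imp_bdd_below compact_imp_bounded)
  then obtain B0 where B0: "\<And>t x. t \<in> {- T..T} \<Longrightarrow> x \<in> {0..A} \<Longrightarrow> B0 \<le> dW t x + d * (x * dW t x - W t x)"
    unfolding bdd_below_def by fastforce
  define B where "B = \<bar>B0\<bar>"
  define D where "D = (1 + d * A)\<^sup>2"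
  have "1 + d * A > 0" using d A(1) by (simp add: add_pos_nonneg)
  then have D: "D > 0" unfolding D_def by (rule zero_less_power)
  \<comment> \<open>On the compact part the weight contributes \<open>d * l\<close>. The second
    summand makes the terms without \<open>l\<close> at most half of it; the third makes
    \<open>d * l / (2 * D)\<close> exceed \<open>M * sqrt l\<close>.\<close>
  define L where "L = 1 + 2 * B / d + (2 * D * M / d)\<^sup>2"
  have L: "L \<ge> 1" "L \<ge> 2 * B / d" "L \<ge> (2 * D * M / d)\<^sup>2"
    using d by (auto simp: L_def B_def)
  have "damp d l t x \<ge> M * sqrt l" if t: "\<bar>t\<bar> \<le> T" and l: "l \<ge> L" and x: "x \<ge> 0" for t l x
  proof (cases "x \<le> A")
    case True
    have "l * d \<ge> 2 * B" using L(2) l d by (simp add: pos_divide_le_eq) (meson mult_right_mono order_trans less_imp_le)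
    then have N: "dW t x + d * (x * dW t x - W t x) + d * l \<ge> d * l / 2"
      using B0[of t x] t x True by (simp add: B_def algebra_simps abs_le_iff)
    have "sqrt l \<ge> 2 * D * M / d"
      using L(3) l by (intro real_le_rsqrt) auto
    then have "2 * D * M \<le> d * sqrt l" using d by (simp add: pos_divide_le_eq mult.commute)
    then have "2 * D * M * sqrt l \<le> (d * sqrt l) * sqrt l"
      using L l by (intro mult_right_mono) auto
    also have "\<dots> = d * l" using L l by simp
    finally have "M * sqrt l \<le> (d * l / 2) / D" using D by (simp add: pos_le_divide_eq mult_ac)
    also have "\<dots> \<le> (d * l / 2) / (1 + d * x)\<^sup>2"
      unfolding D_def
    proof (intro divide_left_mono power_mono)
      show "0 < (1 + d * A)\<^sup>2 * (1 + d * x)\<^sup>2"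
        using d x A by (intro mult_pos_pos zero_less_power add_pos_nonneg) auto
    qed (use d x A True L l in \<open>auto intro!: mult_left_mono add_nonneg_nonneg\<close>)
    also have "\<dots> \<le> damp d l t x" unfolding damp_def by (intro divide_right_mono N) auto
    finally show ?thesis .
  next
    case False
    then have x: "x \<ge> A" "x > 0" "x \<ge> 1" using A by auto
    have l0: "l > 0" using L l by simp
    have "x * dW t x \<ge> (2 * real (2 * r) * v r) / 2 * x ^ (2 * r)"
      unfolding x_dW using A1(2)[OF t, of x] x A by simp
    also have "(2 * real (2 * r) * v r) / 2 * x ^ (2 * r) \<ge> 0" using vr x by simp
    finally have "x * dW t x \<ge> 0" .
    then have dw: "dW t x \<ge> 0" using x by (simp add: zero_le_mult_iff)
    have "x * dW t x - W t x = (\<Sum>k = 1..r. (2 * (2 * real k - 1) * v k) * t ^ (r - k) * x ^ (2 * k))"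
      unfolding x_dW W_def sum_subtractf[symmetric] by (intro sum.cong) (auto simp: algebra_simps)
    also have "\<dots> \<ge> (2 * (2 * real r - 1) * v r) / 2 * x ^ (2 * r)"
      using A2(2)[OF t, of x] x A by simp
    also have "(2 * (2 * real r - 1) * v r) / 2 * x ^ (2 * r) = c * x ^ (2 * r)" by (simp add: c_def)
    finally have xw: "x * dW t x - W t x \<ge> c * x ^ (2 * r)" .
    have "1 / d \<le> x" using A(4) x(1) by linarith
    then have "d * x \<ge> 1" using d by (simp add: pos_divide_le_eq mult.commute)
    then have "damp d l t x \<ge> sqrt (c * l) / (2 * d)"
      using damp_lower_far[OF d x(2) _ l0 c dw xw x(3)] by simp
    also have "sqrt (c * l) / (2 * d) = M * sqrt l"
      using c assms by (simp add: d_def real_sqrt_mult)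
    finally show ?thesis .
  qed
  then show ?thesis using d L(1) by (intro exI[of _ d] conjI exI[of _ L]) auto
qed

section \<open>Comparing the Wronskian with the energies\<close>

lemma energy_0: "energy d True l t 0 = l" "energy d False l t 0 = 1"
  by (simp_all add: energy_def u_0 W_0)

lemma energy_eventually_ge:
  assumes "decaying e l t j" "d > 0" "\<epsilon> > 0"
  shows "\<forall>\<^sub>F x in at_top. energy d e l t x \<ge> - \<epsilon>"
proof -
  obtain K where K: "\<forall>\<^sub>F x in at_top. \<bar>u e l t x\<bar> \<le> K * exp (- x) \<and> \<bar>du e l t x\<bar> \<le> K"
    using decaying_decay[OF assms(1)] by blast
  have "((\<lambda>x. \<Sum>k = 1..r. 2 * v k * t ^ (r - k) * (x ^ (2 * k) / exp x)) \<longlongrightarrow> (\<Sum>k = 1..r. 2 * v k * t ^ (r - k) * 0)) at_top"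
    by (intro tendsto_intros tendsto_power_div_exp_0)
  moreover have "((\<lambda>x. l * (x ^ 0 / exp x)) \<longlongrightarrow> l * 0) at_top"
    by (intro tendsto_intros tendsto_power_div_exp_0)
  ultimately have "((\<lambda>x. (\<Sum>k = 1..r. 2 * v k * t ^ (r - k) * (x ^ (2 * k) / exp x)) - l * (x ^ 0 / exp x)) \<longlongrightarrow> 0) at_top"
    using tendsto_diff by fastforce
  moreover have "(\<Sum>k = 1..r. 2 * v k * t ^ (r - k) * (x ^ (2 * k) / exp x)) - l * (x ^ 0 / exp x) = (W t x - l) / exp x" for x
    by (simp add: W_def sum_divide_distrib diff_divide_distrib)
  ultimately have "((\<lambda>x. (W t x - l) / exp x) \<longlongrightarrow> 0) at_top" by simp
  then have "((\<lambda>x. K\<^sup>2 * ((W t x - l) / exp x)) \<longlongrightarrow> 0) at_top"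
    by (rule tendsto_mult_right_zero)
  then have small: "\<forall>\<^sub>F x in at_top. K\<^sup>2 * ((W t x - l) / exp x) < \<epsilon>"
    using \<open>\<epsilon> > 0\<close> by (rule order_tendstoD(2))
  obtain X where X: "X \<ge> 1" "\<And>l' t' x. \<bar>t'\<bar> \<le> \<bar>t\<bar> \<Longrightarrow> l' \<le> l \<Longrightarrow> x \<ge> X \<Longrightarrow> W t' x - l' \<ge> 2"
    using W_coercive[where T = "\<bar>t\<bar>" and L = l] by blast
  from K small eventually_ge_at_top[of X] show ?thesis
  proof eventually_elim
    case (elim x)
    have Q: "W t x - l \<ge> 2" using X(2)[of t l x] elim by simp
    have x: "x > 0" using X(1) elim by simp
    have "\<bar>u e l t x\<bar>\<^sup>2 \<le> (K * exp (- x))\<^sup>2" using elim by (intro power_mono) auto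
    also have "\<dots> = K\<^sup>2 * exp (- x) * exp (- x)" by (simp add: power2_eq_square)
    also have "\<dots> \<le> K\<^sup>2 * exp (- x) * 1" using x by (intro mult_left_mono) auto
    finally have "(u e l t x)\<^sup>2 \<le> K\<^sup>2 / exp x" by (simp add: exp_minus field_simps)
    then have "(W t x - l) * (u e l t x)\<^sup>2 \<le> (W t x - l) * (K\<^sup>2 / exp x)" using Q by (intro mult_left_mono) auto
    also have "\<dots> = K\<^sup>2 * ((W t x - l) / exp x)" by simp
    finally have "(W t x - l) * (u e l t x)\<^sup>2 < \<epsilon>" using elim by simp
    then have N: "(du e l t x)\<^sup>2 - (W t x - l) * (u e l t x)\<^sup>2 \<ge> - \<epsilon>"
      using zero_le_power2[of "du e l t x"] by linarith
    have g: "1 + d * x \<ge> 1" using \<open>d > 0\<close> x by simp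
    have "- \<epsilon> \<le> - \<epsilon> / (1 + d * x)" using g \<open>\<epsilon> > 0\<close> by (simp add: pos_divide_le_eq)
    also have "\<dots> \<le> energy d e l t x" unfolding energy_def using N g by (intro divide_right_mono) auto
    finally show ?case .
  qed
qed

text \<open>The function \<open>H\<close> replaces integration over the half line. Its derivative is
  nonnegative because the damping of the two energies absorbs \<open>(l - m) * u * v\<close>, and
  decay leaves no positive part at infinity, so \<open>H 0 \<le> 0\<close>. At the origin the
  Wronskian is \<open>1\<close> and the energies are \<open>l\<close> and \<open>1\<close>. The
  parameter \<open>s\<close> is free for balancing the two solutions.\<close>

lemma even_odd_gap:
  assumes bl: "decaying True l t j" and bm: "decaying False m t j'" and "d > 0" "M > 0" "l > 0" "m > 0" "s > 0"
    and dl: "\<And>x. x \<ge> 0 \<Longrightarrow> damp d l t x \<ge> M * sqrt l"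
    and dm: "\<And>x. x \<ge> 0 \<Longrightarrow> damp d m t x \<ge> M * sqrt m"
  shows "1 \<le> \<bar>l - m\<bar> / (2 * M) * (s * sqrt l + 1 / (s * sqrt m))"
proof -
  \<comment> \<open>Each constant makes the damping of one energy pay for one half of
    \<open>2 * \<bar>U * V\<bar> \<le> s * U^2 + V^2 / s\<close>, multiplied by
    \<open>\<bar>l - m\<bar> / 2\<close>.\<close>
  define c1 where "c1 = \<bar>l - m\<bar> * s / (2 * (M * sqrt l))"
  define c2 where "c2 = \<bar>l - m\<bar> / (2 * s * (M * sqrt m))"
  have c: "c1 \<ge> 0" "c2 \<ge> 0" using assms by (simp_all add: c1_def c2_def)
  define w where "w = (\<lambda>x. u True l t x * du False m t x - du True l t x * u False m t x)"
  define E where "E = (\<lambda>x. c1 * energy d True l t x + c2 * energy d False m t x)"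
  define H where "H = (\<lambda>x. w x - E x)"
  have mono: "H 0 \<le> H x" if "x \<ge> 0" for x
  proof (rule DERIV_nonneg_imp_nondecreasing[OF that])
    fix z assume z: "0 \<le> z" "z \<le> x"
    then have g: "1 + d * z > 0" using \<open>d > 0\<close> by (simp add: add_pos_nonneg)
    let ?U = "u True l t z" and ?V = "u False m t z"
    let ?Dl = "- d * (du True l t z)\<^sup>2 / (1 + d * z)\<^sup>2 - damp d l t z * ?U\<^sup>2"
    let ?Dm = "- d * (du False m t z)\<^sup>2 / (1 + d * z)\<^sup>2 - damp d m t z * ?V\<^sup>2"
    have "(H has_real_derivative (l - m) * (?U * ?V) - (c1 * ?Dl + c2 * ?Dm)) (at z)"
      unfolding H_def w_def E_def
      by (intro DERIV_diff DERIV_add DERIV_cmult wronskian_deriv energy_deriv g)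
    moreover have "(l - m) * (?U * ?V) - (c1 * ?Dl + c2 * ?Dm) \<ge> 0"
    proof -
      have nn: "y \<ge> 0 \<Longrightarrow> - d * y / (1 + d * z)\<^sup>2 \<le> 0" for y
        using \<open>d > 0\<close> by (simp add: divide_nonpos_nonneg mult_nonneg_nonneg)
      have "(M * sqrt l) * ?U\<^sup>2 \<le> damp d l t z * ?U\<^sup>2" by (intro mult_right_mono dl z) auto
      then have "?Dl \<le> - (M * sqrt l * ?U\<^sup>2)" using nn[of "(du True l t z)\<^sup>2"] by simp
      then have "c1 * ?Dl \<le> c1 * (- (M * sqrt l * ?U\<^sup>2))" using c by (intro mult_left_mono)
      also have "\<dots> = - (\<bar>l - m\<bar> * (s * ?U\<^sup>2) / 2)" using assms by (simp add: c1_def)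
      finally have 1: "c1 * ?Dl \<le> - (\<bar>l - m\<bar> * (s * ?U\<^sup>2) / 2)" .
      have "(M * sqrt m) * ?V\<^sup>2 \<le> damp d m t z * ?V\<^sup>2" by (intro mult_right_mono dm z) auto
      then have "?Dm \<le> - (M * sqrt m * ?V\<^sup>2)" using nn[of "(du False m t z)\<^sup>2"] by simp
      then have "c2 * ?Dm \<le> c2 * (- (M * sqrt m * ?V\<^sup>2))" using c by (intro mult_left_mono)
      also have "\<dots> = - (\<bar>l - m\<bar> * (?V\<^sup>2 / s) / 2)" using assms by (simp add: c2_def)
      finally have 2: "c2 * ?Dm \<le> - (\<bar>l - m\<bar> * (?V\<^sup>2 / s) / 2)" .
      have "2 * (\<bar>?U\<bar> * \<bar>?V\<bar>) \<le> s * ?U\<^sup>2 + ?V\<^sup>2 / s"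
      proof -
        have "2 * (sqrt s * \<bar>?U\<bar>) * (\<bar>?V\<bar> / sqrt s) \<le> (sqrt s * \<bar>?U\<bar>)\<^sup>2 + (\<bar>?V\<bar> / sqrt s)\<^sup>2"
          by (rule sum_squares_bound)
        then show ?thesis using \<open>s > 0\<close> by (simp add: power_mult_distrib power_divide)
      qed
      then have "\<bar>l - m\<bar> * (2 * (\<bar>?U\<bar> * \<bar>?V\<bar>)) \<le> \<bar>l - m\<bar> * (s * ?U\<^sup>2 + ?V\<^sup>2 / s)"
        by (intro mult_left_mono) auto
      moreover have "- ((l - m) * (?U * ?V)) \<le> \<bar>l - m\<bar> * (\<bar>?U\<bar> * \<bar>?V\<bar>)"
        unfolding abs_mult[symmetric] by (metis abs_ge_minus_self)
      moreover have "- n \<le> p * y1 / 2 + p * y2 / 2" if "p * (2 * w) \<le> p * (y1 + y2)" "- n \<le> p * w" for n p w y1 y2 :: real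
        using that by (simp add: algebra_simps)
      ultimately have "- ((l - m) * (?U * ?V)) \<le> \<bar>l - m\<bar> * (s * ?U\<^sup>2) / 2 + \<bar>l - m\<bar> * (?V\<^sup>2 / s) / 2"
        by blast
      then show ?thesis using 1 2 by linarith
    qed
    ultimately show "\<exists>y. (H has_real_derivative y) (at z) \<and> 0 \<le> y" by blast
  qed
  have "H 0 \<le> 0 + \<epsilon>" if "\<epsilon> > 0" for \<epsilon>
  proof -
    define \<delta> where "\<delta> = \<epsilon> / (1 + c1 + c2)"
    have \<delta>: "\<delta> > 0" using that c by (simp add: \<delta>_def)
    have "(w \<longlongrightarrow> 0) at_top" unfolding w_def by (rule decaying_wronskian_tendsto_0[OF bl bm])
    then have "\<forall>\<^sub>F x in at_top. w x < \<delta>" using \<delta> by (rule order_tendstoD(2))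
    with energy_eventually_ge[OF bl \<open>d > 0\<close> \<delta>] energy_eventually_ge[OF bm \<open>d > 0\<close> \<delta>]
    have "\<forall>\<^sub>F x in at_top. w x < \<delta> \<and> energy d True l t x \<ge> - \<delta> \<and> energy d False m t x \<ge> - \<delta>"
      by eventually_elim auto
    then obtain x where x: "x \<ge> 0" "w x < \<delta>" "energy d True l t x \<ge> - \<delta>" "energy d False m t x \<ge> - \<delta>"
      by (rule eventually_sample[of _ 0]) auto
    have "c1 * (- \<delta>) \<le> c1 * energy d True l t x" "c2 * (- \<delta>) \<le> c2 * energy d False m t x"
      using x c by (intro mult_left_mono; simp)+
    then have "H x \<le> \<delta> + c1 * \<delta> + c2 * \<delta>" using x(2) by (simp add: H_def E_def)
    also have "\<dots> = \<delta> * (1 + c1 + c2)" by (simp add: algebra_simps)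
    also have "\<dots> = \<epsilon>" using c by (simp add: \<delta>_def)
    finally show ?thesis using mono[OF x(1)] by simp
  qed
  then have "H 0 \<le> 0" by (rule field_le_epsilon)
  moreover have "H 0 = 1 - (c1 * l + c2)"
    by (simp add: H_def w_def E_def energy_0 u_0)
  ultimately have "1 \<le> c1 * l + c2" by simp
  also have "c1 * l = \<bar>l - m\<bar> / (2 * M) * (s * sqrt l)"
  proof -
    have "l / sqrt l = sqrt l" using \<open>l > 0\<close> by (simp add: real_div_sqrt)
    then have "\<bar>l - m\<bar> * s / (2 * M) * (l / sqrt l) = \<bar>l - m\<bar> / (2 * M) * (s * sqrt l)" by simp
    then show ?thesis by (simp add: c1_def mult_ac)
  qed
  also have "c2 = \<bar>l - m\<bar> / (2 * M) * (1 / (s * sqrt m))" by (simp add: c2_def mult_ac)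
  finally show ?thesis by (simp only: distrib_left)
qed

text \<open>Consecutive eigenvalues have opposite parity, so separating even from odd eigenvalues is
  enough.\<close>

lemma gap_large:
  assumes "K > 0"
  shows "\<exists>L. \<forall>t n. \<bar>t\<bar> \<le> T \<longrightarrow> eigval n t \<ge> L \<longrightarrow> eigval (Suc n) t - eigval n t \<ge> K"
proof -
  have "2 * K > 0" using assms by simp
  then obtain d L0 where d: "d > 0" "L0 > 0"
    "\<And>t l x. \<bar>t\<bar> \<le> T \<Longrightarrow> l \<ge> L0 \<Longrightarrow> x \<ge> 0 \<Longrightarrow> damp d l t x \<ge> (2 * K) * sqrt l"
    using damp_lower[of "2 * K" T] by metis
  \<comment> \<open>The bound \<open>m \<ge> K\<close> makes eigenvalues at distance less than
    \<open>K\<close> comparable: \<open>l \<le> 4 * m\<close>.\<close>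
  define L where "L = max L0 K"
  have main: "\<bar>l - m\<bar> \<ge> K"
    if t: "\<bar>t\<bar> \<le> T" and b: "decaying True l t j" "decaying False m t j'" and lm: "l \<ge> L" "m \<ge> L" for t l m j j'
  proof (rule ccontr)
    assume "\<not> \<bar>l - m\<bar> \<ge> K"
    then have lt: "\<bar>l - m\<bar> < K" by simp
    have pos: "l > 0" "m > 0" "m \<ge> K" using lm assms by (auto simp: L_def)
    \<comment> \<open>The choice \<open>s = 1 / sqrt m\<close> normalizes the odd term to
      \<open>1\<close> and bounds the even one by \<open>2\<close>. With \<open>M = 2 * K\<close>
      the right side is then below \<open>3 / 4\<close>.\<close>
    have "1 \<le> \<bar>l - m\<bar> / (2 * (2 * K)) * ((1 / sqrt m) * sqrt l + 1 / ((1 / sqrt m) * sqrt m))"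
      using lm t pos assms d by (intro even_odd_gap[OF b, of d]) (auto simp: L_def)
    also have "\<dots> \<le> \<bar>l - m\<bar> / (2 * (2 * K)) * 3"
    proof (intro mult_left_mono)
      have "l \<le> 4 * m" using lt pos by linarith
      then have "sqrt l \<le> sqrt (4 * m)" by (rule real_sqrt_le_mono)
      also have "\<dots> = 2 * sqrt m" by (simp add: real_sqrt_mult)
      finally have "(1 / sqrt m) * sqrt l \<le> 2" using pos by (simp add: pos_divide_le_eq)
      then show "(1 / sqrt m) * sqrt l + 1 / ((1 / sqrt m) * sqrt m) \<le> 3" using pos by simp
    qed (use assms in auto)
    also have "\<dots> < 1" using lt assms by (simp add: pos_divide_less_eq)
    finally show False by simp
  qed
  have "eigval (Suc n) t - eigval n t \<ge> K" if "\<bar>t\<bar> \<le> T" "eigval n t \<ge> L" for t n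
  proof -
    have b: "\<exists>j. decaying (even k) (eigval k t) t j" for k unfolding eigval_def using decaying_parity_eigval by blast
    have "eigval (Suc n) t \<ge> L" using that(2) eigval_less_Suc[of n t] by linarith
    then have "\<bar>eigval (Suc n) t - eigval n t\<bar> \<ge> K"
      using b[of n] b[of "Suc n"] main[OF that(1), of "eigval n t" _ "eigval (Suc n) t"] main[OF that(1), of "eigval (Suc n) t" _ "eigval n t"] that(2)
      by (cases "even n") (auto simp: abs_minus_commute)
    then show ?thesis using eigval_less_Suc[of n t] by simp
  qed
  then show ?thesis by blast
qed

end

section \<open>The smallest gap\<close>

lemma continuous_on_Min:
  fixes f :: "'i \<Rightarrow> 'a::topological_space \<Rightarrow> real"
  assumes "finite I" "I \<noteq> {}" "\<And>i. i \<in> I \<Longrightarrow> continuous_on A (f i)"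
  shows "continuous_on A (\<lambda>x. Min ((\<lambda>i. f i x) ` I))"
  using assms
proof (induction rule: finite_ne_induct)
  case (insert i I)
  then have "(\<lambda>x. Min ((\<lambda>i. f i x) ` insert i I)) = (\<lambda>x. min (f i x) (Min ((\<lambda>i. f i x) ` I)))"
    by auto
  then show ?case using insert by (auto intro!: continuous_intros)
qed simp

lemma Inf_range_strict_mono:
  fixes f :: "nat \<Rightarrow> real"
  assumes "strict_mono f"
  shows "Inf (range f) = f 0" "Inf {E \<in> range f. E > f n} = f (Suc n)"
proof -
  show "Inf (range f) = f 0"
    by (rule cInf_eq_minimum) (use assms in \<open>auto simp: strict_mono_less_eq\<close>)
  show "Inf {E \<in> range f. E > f n} = f (Suc n)"
    by (rule cInf_eq_minimum) (use assms in \<open>auto simp: strict_mono_less_eq strict_mono_less\<close>)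
qed

context anharmonic
begin

definition min_gap :: "real \<Rightarrow> real" where
  "min_gap t = (INF n. eigval (Suc n) t - eigval n t)"

text \<open>The summand \<open>1\<close> in \<open>D\<close> leaves room for the first gap to vary
  near \<open>t0\<close>. One index \<open>N\<close> serves a whole neighbourhood because
  \<open>eigval N\<close> stays above the level where all gaps are at least
  \<open>D\<close>.\<close>

lemma min_gap_local:
  obtains N where "\<forall>\<^sub>F t in nhds t0. \<forall>n>N. eigval 1 t - eigval 0 t < eigval (Suc n) t - eigval n t"
proof -
  define D where "D = eigval 1 t0 - eigval 0 t0 + 1"
  have D: "D > 0" using eigval_less_Suc[of 0 t0] by (simp add: D_def)
  obtain L where L: "\<And>t n. \<bar>t\<bar> \<le> \<bar>t0\<bar> + 1 \<Longrightarrow> eigval n t \<ge> L \<Longrightarrow> eigval (Suc n) t - eigval n t \<ge> D"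
    using gap_large[OF D] by blast
  obtain N where N: "L < eigval N t0" using eigval_unbounded by blast
  have lim: "(eigval n \<longlongrightarrow> eigval n t0) (nhds t0)" for n
  proof -
    have "isCont (eigval n) t0" using continuous_on_eigval[of UNIV n] by (simp add: continuous_on_eq_continuous_at)
    then show ?thesis using tendsto_at_iff_tendsto_nhds[of "eigval n" t0] by (simp add: isCont_def)
  qed
  have "\<forall>\<^sub>F t in nhds t0. L < eigval N t" by (rule order_tendstoD(1)[OF lim N])
  moreover have "\<forall>\<^sub>F t in nhds t0. eigval 1 t - eigval 0 t < D"
    by (rule order_tendstoD(2)[OF tendsto_diff[OF lim lim]]) (simp add: D_def)
  moreover have "\<forall>\<^sub>F t in nhds t0. \<bar>t\<bar> < \<bar>t0\<bar> + 1"
    by (rule order_tendstoD(2)[OF tendsto_rabs[OF filterlim_ident]]) simp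
  ultimately have "\<forall>\<^sub>F t in nhds t0. \<forall>n>N. eigval 1 t - eigval 0 t < eigval (Suc n) t - eigval n t"
  proof eventually_elim
    case (elim t)
    show ?case
    proof (intro allI impI)
      fix n assume "n > N"
      then have "eigval N t < eigval n t" by (rule strict_monoD[OF strict_mono_eigval])
      then have "eigval (Suc n) t - eigval n t \<ge> D" using elim by (intro L) auto
      then show "eigval 1 t - eigval 0 t < eigval (Suc n) t - eigval n t" using elim by linarith
    qed
  qed
  then show thesis by (rule that)
qed

lemma min_gap_Min:
  assumes "\<forall>n>N. eigval 1 t - eigval 0 t < eigval (Suc n) t - eigval n t"
  shows "min_gap t = Min ((\<lambda>n. eigval (Suc n) t - eigval n t) ` {..N})"
  unfolding min_gap_def
proof (rule cInf_eq_minimum)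
  let ?g = "\<lambda>n. eigval (Suc n) t - eigval n t"
  have "Min (?g ` {..N}) \<in> ?g ` {..N}" by (rule Min_in) auto
  then show "Min (?g ` {..N}) \<in> range ?g" by blast
  have le: "Min (?g ` {..N}) \<le> ?g n" if "n \<le> N" for n
    using that by (intro Min_le) auto
  fix y assume "y \<in> range ?g"
  then obtain n where n: "y = ?g n" by blast
  show "Min (?g ` {..N}) \<le> y"
  proof (cases "n \<le> N")
    case True
    then show ?thesis using le n by simp
  next
    case False
    then have "?g 0 < ?g n" using assms by simp
    then show ?thesis using le[of 0] n by linarith
  qed
qed

text \<open>Attainment is what turns positivity of each gap into positivity of the infimum.\<close>

lemma min_gap_attained: "\<exists>n. min_gap t = eigval (Suc n) t - eigval n t \<and> (\<forall>k. eigval (Suc n) t - eigval n t \<le> eigval (Suc k) t - eigval k t)"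
proof -
  let ?g = "\<lambda>n. eigval (Suc n) t - eigval n t"
  obtain N where "\<forall>\<^sub>F s in nhds t. \<forall>n>N. eigval 1 s - eigval 0 s < eigval (Suc n) s - eigval n s" by (rule min_gap_local)
  then have "min_gap t = Min (?g ` {..N})" by (intro min_gap_Min) (rule eventually_nhds_x_imp_x)
  moreover have "Min (?g ` {..N}) \<in> ?g ` {..N}" by (rule Min_in) auto
  ultimately have "min_gap t \<in> ?g ` {..N}" by (simp only:)
  then obtain n where n: "min_gap t = ?g n" by blast
  have "bdd_below (range ?g)"
    using eigval_less_Suc by (intro bdd_belowI2[of _ 0]) (simp add: less_imp_le)
  then have "min_gap t \<le> ?g k" for k unfolding min_gap_def by (intro cINF_lower) auto
  then show ?thesis using n by auto
qed

lemma min_gap_pos: "min_gap t > 0"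
  using min_gap_attained[of t] eigval_less_Suc[of _ t] by auto

lemma isCont_min_gap: "isCont min_gap t0"
proof -
  obtain N where N: "\<forall>\<^sub>F t in nhds t0. \<forall>n>N. eigval 1 t - eigval 0 t < eigval (Suc n) t - eigval n t" by (rule min_gap_local)
  have "continuous_on UNIV (\<lambda>t. Min ((\<lambda>n. eigval (Suc n) t - eigval n t) ` {..N}))"
    by (intro continuous_on_Min continuous_on_diff continuous_on_eigval) auto
  then have "isCont (\<lambda>t. Min ((\<lambda>n. eigval (Suc n) t - eigval n t) ` {..N})) t0"
    by (simp add: continuous_on_eq_continuous_at)
  moreover have "\<forall>\<^sub>F t in nhds t0. min_gap t = Min ((\<lambda>n. eigval (Suc n) t - eigval n t) ` {..N})"
    using N by eventually_elim (rule min_gap_Min)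
  ultimately show ?thesis by (simp add: isCont_cong)
qed

lemma gap_eq:
  assumes t: "t > 0" and pot: "\<And>x. pot a b r x = P x"
  shows "gap (t ^ (r + 1)) a b r = min_gap t / (2 * t ^ r)"
proof -
  define f where "f = (\<lambda>n. eigval n t / (2 * t ^ r))"
  have c: "2 * t ^ r > 0" using t by simp
  have spec: "spec (t ^ (r + 1)) a b r = range f"
  proof -
    have "E \<in> spec (t ^ (r + 1)) a b r \<longleftrightarrow> 2 * t ^ r * E \<in> range (\<lambda>n. eigval n t)" for E
      unfolding spec_def using is_eigenvalue_iff[OF t pot] decaying_iff_eigval by simp
    moreover have "2 * t ^ r * E = eigval n t \<longleftrightarrow> E = f n" for E n
      using t by (simp add: f_def eq_divide_eq mult.commute)
    ultimately show ?thesis by (simp only: set_eq_iff image_iff bex_UNIV) simp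
  qed
  have mono: "strict_mono f"
    using strict_mono_eigval[of t] c by (simp add: f_def strict_mono_def divide_strict_right_mono)
  have eig: "eig (t ^ (r + 1)) a b r n = f n" for n
    by (induction n) (simp_all only: eig.simps spec Inf_range_strict_mono[OF mono])
  have diff: "f (Suc n) - f n = (eigval (Suc n) t - eigval n t) / (2 * t ^ r)" for n
    by (simp add: f_def diff_divide_distrib)
  obtain n where n: "min_gap t = eigval (Suc n) t - eigval n t" "\<And>k. eigval (Suc n) t - eigval n t \<le> eigval (Suc k) t - eigval k t"
    using min_gap_attained by blast
  show ?thesis
    unfolding gap_def eig diff n(1)
    by (rule cInf_eq_minimum) (use n(2) c in \<open>auto intro!: divide_right_mono\<close>)
qed

end

section \<open>Return to the mass parameter\<close>

theorem theorem4p1: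
  fixes r :: nat and a :: real and b :: "nat \<Rightarrow> real"
  assumes "r \<ge> 2" and "a > 0" and "b r > 0"
  shows "continuous_on {0<..} (\<lambda>m. gap m a b r)
       \<and> continuous_on {0<..} (\<lambda>m. rigidity m a b r)
       \<and> (\<exists>\<Delta>0 > 0.
            (\<lambda>m. gap m a b r) \<sim>[at_right 0] (\<lambda>m. \<Delta>0 * m powr (- (real r / real (r + 1))))
          \<and> (\<lambda>m. rigidity m a b r) \<sim>[at_right 0]
              (\<lambda>m. \<Delta>0\<^sup>2 * m powr (- ((real r - 1) / real (r + 1)))))"
proof -
  \<comment> \<open>The harmonic term \<open>a / 2 * x ^ 2\<close> is merged with the quadratic term
    of the perturbation.\<close>
  define v where "v = (\<lambda>k. if k = 1 then b 1 + a / 2 else b k)"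
  interpret anharmonic r v
    using assms by unfold_locales (auto simp: v_def)
  have pot: "pot a b r x = P x" for x
  proof -
    have "{1..r} = insert 1 {2..r}" using assms by auto
    moreover have "(\<Sum>k = 2..r. v k * x ^ (2 * k)) = (\<Sum>k = 2..r. b k * x ^ (2 * k))"
      by (intro sum.cong) (auto simp: v_def)
    moreover have "v 1 = b 1 + a / 2" by (simp add: v_def)
    ultimately show ?thesis by (simp add: pot_def P_def algebra_simps power2_eq_square)
  qed
  define \<tau> where "\<tau> = (\<lambda>m::real. m powr (1 / real (r + 1)))"
  have \<tau>: "\<tau> m > 0" "\<tau> m ^ (r + 1) = m" "\<tau> m ^ r = m powr (real r / real (r + 1))" if "m > 0" for m
  proof -
    show "\<tau> m > 0" using that by (simp add: \<tau>_def)
    have *: "\<tau> m ^ n = m powr (real n / real (r + 1))" for n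
      using that by (simp add: \<tau>_def powr_realpow[symmetric] powr_powr)
    show "\<tau> m ^ r = m powr (real r / real (r + 1))" by (rule *)
    show "\<tau> m ^ (r + 1) = m" unfolding * using that by simp
  qed
  have gap: "gap m a b r = min_gap (\<tau> m) / (2 * m powr (real r / real (r + 1)))" if "m > 0" for m
    using gap_eq[OF \<tau>(1)[OF that], of a b, OF pot] \<tau>(2,3)[OF that] by simp
  have contG: "continuous_on A (\<lambda>m. min_gap (f m))" if "continuous_on A f" for A and f :: "real \<Rightarrow> real"
    using that isCont_min_gap continuous_at_imp_continuous_on[of UNIV min_gap]
    by (auto intro: continuous_on_compose2[of UNIV min_gap])
  have "continuous_on {0<..} (\<lambda>m. min_gap (\<tau> m) / (2 * m powr (real r / real (r + 1))))"
    unfolding \<tau>_def by (intro continuous_intros contG) auto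
  then have cont: "continuous_on {0<..} (\<lambda>m. gap m a b r)"
    by (rule continuous_on_eq) (simp add: gap)
  then have cont': "continuous_on {0<..} (\<lambda>m. rigidity m a b r)"
    unfolding rigidity_def by (intro continuous_intros)
  define \<Delta>0 where "\<Delta>0 = min_gap 0 / 2"
  have \<Delta>0: "\<Delta>0 > 0" using min_gap_pos[of 0] by (simp add: \<Delta>0_def)
  \<comment> \<open>The power of \<open>m\<close> is already exact in \<open>gap\<close>, so the
    asymptotics only need that \<open>min_gap (\<tau> m)\<close> tends to the positive number
    \<open>min_gap 0\<close>.\<close>
  have "(\<tau> \<longlongrightarrow> 0) (at_right 0)"
    unfolding \<tau>_def
    by (rule tendsto_zero_powrI[where b = "1 / real (r + 1)"])
      (auto intro!: tendsto_intros eventually_mono[OF eventually_at_right_less] filterlim_ident)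
  then have "((\<lambda>m. min_gap (\<tau> m)) \<longlongrightarrow> min_gap 0) (at_right 0)"
    by (rule isCont_tendsto_compose[OF isCont_min_gap])
  then have "((\<lambda>m. min_gap (\<tau> m) / min_gap 0) \<longlongrightarrow> min_gap 0 / min_gap 0) (at_right 0)"
    using min_gap_pos[of 0] by (intro tendsto_divide tendsto_const) auto
  then have ratio: "((\<lambda>m. min_gap (\<tau> m) / min_gap 0) \<longlongrightarrow> 1) (at_right 0)"
    using min_gap_pos[of 0] by simp
  have pos: "\<forall>\<^sub>F m in at_right (0::real). m > 0" by (rule eventually_at_right_less)
  have "((\<lambda>m. gap m a b r / (\<Delta>0 * m powr (- (real r / real (r + 1))))) \<longlongrightarrow> 1) (at_right 0)"
    using ratio
  proof (rule Lim_transform_eventually)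
    show "\<forall>\<^sub>F m in at_right 0. min_gap (\<tau> m) / min_gap 0 = gap m a b r / (\<Delta>0 * m powr (- (real r / real (r + 1))))"
      using pos by eventually_elim (simp add: gap \<Delta>0_def powr_minus divide_simps)
  qed
  then have gap_asymp: "(\<lambda>m. gap m a b r) \<sim>[at_right 0] (\<lambda>m. \<Delta>0 * m powr (- (real r / real (r + 1))))"
    by (rule asymp_equivI')
  then have "(\<lambda>m. m * (gap m a b r)\<^sup>2) \<sim>[at_right 0] (\<lambda>m. m * (\<Delta>0 * m powr (- (real r / real (r + 1))))\<^sup>2)"
    by (intro asymp_equiv_intros)
  also have "(\<lambda>m. m * (\<Delta>0 * m powr (- (real r / real (r + 1))))\<^sup>2) \<sim>[at_right 0]
      (\<lambda>m. \<Delta>0\<^sup>2 * m powr (- ((real r - 1) / real (r + 1))))"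
  proof (rule asymp_equiv_refl_ev)
    show "\<forall>\<^sub>F m in at_right 0. m * (\<Delta>0 * m powr (- (real r / real (r + 1))))\<^sup>2 = \<Delta>0\<^sup>2 * m powr (- ((real r - 1) / real (r + 1)))"
      using pos
    proof eventually_elim
      case (elim m)
      have "m * (m powr c)\<^sup>2 = m powr (1 + (c + c))" for c
        unfolding powr_add power2_eq_square using elim by simp
      then have "m * (m powr (- (real r / real (r + 1))))\<^sup>2
          = m powr (1 + (- (real r / real (r + 1)) + - (real r / real (r + 1))))" .
      also have "1 + (- (real r / real (r + 1)) + - (real r / real (r + 1))) = (real (r + 1) - real r - real r) / real (r + 1)"
        unfolding diff_divide_distrib by simp
      also have "\<dots> = - ((real r - 1) / real (r + 1))"
        unfolding minus_divide_left by simp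
      finally show ?case by (simp add: power_mult_distrib mult_ac)
    qed
  qed
  finally have "(\<lambda>m. rigidity m a b r) \<sim>[at_right 0] (\<lambda>m. \<Delta>0\<^sup>2 * m powr (- ((real r - 1) / real (r + 1))))"
    unfolding rigidity_def .
  with cont cont' \<Delta>0 gap_asymp show ?thesis by blast
qed

end
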